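(* Let $\mathcal{F}$ be a 2-capturing construction scheme with $\mathfrak{m}_{\mathcal{F}}>\omega_1$, and let $\pi:\omega_1\to\omega$ be a surjection such that $\pi^{-1}[\{n\}]\notin\mathcal{V}(\mathcal{F})$ for every $n\in\omega$. Then $\pi\mathcal{V}(\mathcal{F})=\{A\subseteq\omega:\pi^{-1}[A]\in\mathcal{V}(\mathcal{F})\}$ is a Ramsey ultrafilter on $\omega$.
   Context: Types: $\tau=\langle m_k,n_{k+1},r_{k+1}\rangle_{k\in\omega}$ with $m_0=1$, $n_{k+1}\ge2$, $m_k>r_{k+1}$, $m_{k+1}=r_{k+1}+(m_k-r_{k+1})n_{k+1}$, assumed good (each $r$ equals $r_k$ for infinitely many $k$). A construction scheme of type $\tau$ is a family $\mathcal{F}$ of nonempty finite subsets of $\omega_1$, cofinal under $\subseteq$, each of size some $m_k$, such that with $\mathcal{F}_k=\{F\in\mathcal{F}:|F|=m_k\}$: (i) for $E,F\in\mathcal{F}_k$, $E\cap F$ is an initial segment of both; (ii) each $F\in\mathcal{F}_{k+1}$ is $F_0\cup\dots\cup F_{n_{k+1}-1}$ with $F_i\in\mathcal{F}_k$ a $\Delta$-system with root $R(F)$, $|R(F)|=r_{k+1}$, $R(F)<F_0\setminus R(F)<\dots<F_{n_{k+1}-1}\setminus R(F)$. Let $\rho(\alpha,\beta)=\min\{k:\exists F\in\mathcal{F}_k\ \{\alpha,\beta\}\subseteq F\}$; $(\beta)_k=\{\xi\le\beta:\rho(\beta,\xi)\le k\}$, $\|\alpha\|_k=|(\alpha)_k\setminus\{\alpha\}|$,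 $\Delta(\alpha,\beta)=\min\{k:\|\alpha\|_k\ne\|\beta\|_k\}$. $\Xi_\alpha(0)=0$; for $k\ge1$ and $F\in\mathcal{F}_k$ containing $\alpha$, $\Xi_\alpha(k)=-1$ if $\alpha\in R(F)$, $=i$ if $\alpha\in F_i\setminus R(F)$. $D(a)$ is the $a$-th element of a finite set $D$ of ordinals. A family $\langle D_i\rangle_{i<n}$ of subsets of $\omega_1$ each of size $m$ forming a root-tail-tail $\Delta$-system (pairwise intersections equal a root $R$, $|R|=r$, $R<D_i\setminus R$, $D_0\setminus R<D_1\setminus R<\dots$) is captured at level $l$ if $\Xi_{D_i(a)}(l)=-1$ for $a<r$, $=i$ for $r\le a<m$, and $\rho(D_i(a),D_j(a))=l=\Delta(D_i(a),D_j(a))$ for $i<j<n$, $r\le a<m$; a pair $\{\alpha,\beta\}$ is captured if $\{\{\alpha\},\{\beta\}\}$ is captured at some level. $\mathcal{F}$ is $n$-capturing if for every uncountable family $\mathcal{S}$ of finite subsets of $\omega_1$ there are infinitely many $l$ such that some $n$ members of $\mathcal{S}$ form a family captured at level $l$. $\mathfrak{m}(\mathbb{P})$ is the least $\kappa$ such that some $\kappa$ dense subsets of $\mathbb{P}$ are not all met by one filter; $\mathfrak{m}_{\mathcal{F}}=\min\{\mathfrak{m}(\mathbb{P}):\mathbb{P}\text{ ccc},\ \mathbb{P}\Vdash\mathcal{F}\text{ is 2-capturing}\}$ when $\mathcal{F}$ is 2-capturing. For $\alpha<\beta<\omega_1$ let $[\alpha,\beta]_{\mathcal{F}}=\min\big((\beta)_{\rho(\alpha,\beta)-1}\setminus\alpha\big)$;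 for $S\subseteq\omega_1$, $\langle S\rangle_{\mathcal{F}}=\{[\alpha,\beta]_{\mathcal{F}}:\alpha<\beta\in S,\ \{\alpha,\beta\}\text{ captured}\}$; $\mathcal{V}(\mathcal{F})=\{A\subseteq\omega_1:\exists S\in[\omega_1]^{\omega_1}\ \langle S\rangle_{\mathcal{F}}\subseteq A\}$. An ultrafilter $\mathcal{U}$ on $\omega$ is Ramsey if for every infinite partition of $\omega$ into sets not in $\mathcal{U}$ there is $A\in\mathcal{U}$ meeting each piece in at most one point. *)

theory Defs
  imports "HOL-Library.Countable_Set_Type" "HOL-Library.Disjoint_Sets"
begin

unbundle cardinal_syntax

section \<open>The ordinal \<open>\<omega>\<^sub>1\<close>\<close>

text \<open>The well-order \<open>cardSuc natLeq\<close> is an initial well-order of cardinality \<open>\<aleph>\<^sub>1\<close>, so its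
  field ordered by it is a copy of \<open>\<omega>\<^sub>1\<close>.\<close>

typedef omega1 = "Field (cardSuc natLeq)"
proof -
  have "natLeq <o |Field (cardSuc natLeq)|"
    by (rule ordLess_ordIso_trans[OF cardSuc_greater[OF natLeq_Card_order]
          ordIso_symmetric[OF card_of_Field_ordIso[OF cardSuc_Card_order[OF natLeq_Card_order]]]])
  then have "infinite (Field (cardSuc natLeq))"
    using infinite_iff_natLeq_ordLeq ordLess_imp_ordLeq by blast
  then show ?thesis by (metis ex_in_conv finite.emptyI)
qed

lemma cardSuc_natLeq_well_order: "Well_order (cardSuc natLeq)"
  using cardSuc_Well_order natLeq_Card_order by blast

instantiation omega1 :: wellorder
begin

definition less_eq_omega1 :: "omega1 \<Rightarrow> omega1 \<Rightarrow> bool" where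
  "\<alpha> \<le> \<beta> \<longleftrightarrow> (Rep_omega1 \<alpha>, Rep_omega1 \<beta>) \<in> cardSuc natLeq"

definition less_omega1 :: "omega1 \<Rightarrow> omega1 \<Rightarrow> bool" where
  "\<alpha> < \<beta> \<longleftrightarrow> \<alpha> \<le> \<beta> \<and> \<not> \<beta> \<le> (\<alpha>::omega1)"

instance
proof -
  let ?r = "cardSuc natLeq"
  have r: "refl_on (Field ?r) ?r" "trans ?r" "antisym ?r" "total_on (Field ?r) ?r" "wf (?r - Id)"
    using cardSuc_natLeq_well_order
    by (auto simp: well_order_on_def linear_order_on_def partial_order_on_def preorder_on_def)
  have refl: "\<alpha> \<le> \<alpha>" for \<alpha> :: omega1
    using r(1) Rep_omega1 by (auto simp: less_eq_omega1_def refl_on_def)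
  have anti: "\<alpha> \<le> \<beta> \<Longrightarrow> \<beta> \<le> \<alpha> \<Longrightarrow> \<alpha> = \<beta>" for \<alpha> \<beta> :: omega1
    using antisymD[OF r(3)] unfolding less_eq_omega1_def by (metis Rep_omega1_inject)
  have "wf (inv_image (?r - Id) Rep_omega1)"
    using r(5) by (rule wf_inv_image)
  moreover have "inv_image (?r - Id) Rep_omega1 = {(\<alpha>, \<beta>). \<alpha> < \<beta>}"
    using anti
    by (auto simp: inv_image_def less_omega1_def less_eq_omega1_def[symmetric] Rep_omega1_inject)
  ultimately have wf: "wf {(\<alpha>, \<beta>::omega1). \<alpha> < \<beta>}" by simp
  show "OFCLASS(omega1, wellorder_class)"
  proof
    fix \<alpha> \<beta> \<gamma> :: omega1
    show "\<alpha> \<le> \<alpha>" by (rule refl)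
    show "\<alpha> < \<beta> \<longleftrightarrow> \<alpha> \<le> \<beta> \<and> \<not> \<beta> \<le> \<alpha>" by (rule less_omega1_def)
    show "\<alpha> \<le> \<beta> \<Longrightarrow> \<beta> \<le> \<gamma> \<Longrightarrow> \<alpha> \<le> \<gamma>"
      unfolding less_eq_omega1_def by (rule transD[OF r(2)])
    show "\<alpha> \<le> \<beta> \<Longrightarrow> \<beta> \<le> \<alpha> \<Longrightarrow> \<alpha> = \<beta>" by (rule anti)
    show "\<alpha> \<le> \<beta> \<or> \<beta> \<le> \<alpha>"
      using r(4) refl Rep_omega1 unfolding less_eq_omega1_def total_on_def by metis
    show "P \<alpha>" if "\<And>\<xi>. (\<And>\<eta>. \<eta> < \<xi> \<Longrightarrow> P \<eta>) \<Longrightarrow> P \<xi>" for P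
      using wf by (rule wf_induct_rule) (simp add: that)
  qed
qed

end

lemma card_omega1: "|UNIV :: omega1 set| =o cardSuc natLeq"
proof -
  have "inj Rep_omega1"
    by (simp add: inj_on_def Rep_omega1_inject)
  moreover have "range Rep_omega1 = Field (cardSuc natLeq)"
    by (rule type_definition.Rep_range[OF type_definition_omega1])
  ultimately have "bij_betw Rep_omega1 UNIV (Field (cardSuc natLeq))"
    by (simp add: bij_betw_def)
  then have "|UNIV :: omega1 set| =o |Field (cardSuc natLeq)|"
    by (rule card_of_ordIsoI)
  then show ?thesis
    by (rule ordIso_transitive[OF _ card_of_Field_ordIso[OF cardSuc_Card_order[OF natLeq_Card_order]]])
qed

lemma uncountable_omega1: "uncountable (UNIV :: omega1 set)"
proof -
  have "natLeq <o |UNIV :: omega1 set|"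
    by (rule ordLess_ordIso_trans[OF cardSuc_greater[OF natLeq_Card_order]
          ordIso_symmetric[OF card_omega1]])
  then show ?thesis
    using not_ordLess_ordLeq by (simp add: countable_card_le_natLeq)
qed

lemma countable_below_omega1: "countable {..<\<alpha>::omega1}"
proof -
  let ?r = "cardSuc natLeq"
  have "Rep_omega1 ` {..<\<alpha>} \<subseteq> underS ?r (Rep_omega1 \<alpha>)"
    by (auto simp: underS_def less_eq_omega1_def less_omega1_def Rep_omega1_inject)
  have "|underS ?r (Rep_omega1 \<alpha>)| <o ?r"
    by (rule card_of_underS[OF cardSuc_Card_order[OF natLeq_Card_order] Rep_omega1])
  then have "countable (underS ?r (Rep_omega1 \<alpha>))"
    by (simp add: countable_card_le_natLeq
        cardSuc_ordLeq_ordLess[OF natLeq_Card_order card_of_Card_order])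
  with \<open>Rep_omega1 ` {..<\<alpha>} \<subseteq> underS ?r (Rep_omega1 \<alpha>)\<close> have "countable (Rep_omega1 ` {..<\<alpha>})"
    by (rule countable_subset)
  then show ?thesis
    by (rule countable_image_inj_on) (simp add: inj_on_def Rep_omega1_inject)
qed


section \<open>Construction schemes\<close>

text \<open>In a type, only \<open>nn (Suc k)\<close> and \<open>rr (Suc k)\<close> are meaningful; the values of \<open>nn\<close> and
  \<open>rr\<close> at \<open>0\<close> are never used.\<close>

record scheme_type =
  mm :: "nat \<Rightarrow> nat"
  nn :: "nat \<Rightarrow> nat"
  rr :: "nat \<Rightarrow> nat"

definition good_type :: "scheme_type \<Rightarrow> bool" where
  "good_type \<tau> \<longleftrightarrow>
     mm \<tau> 0 = 1 \<and>
     (\<forall>k. nn \<tau> (Suc k) \<ge> 2 \<and>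
          mm \<tau> k > rr \<tau> (Suc k) \<and>
          mm \<tau> (Suc k) = rr \<tau> (Suc k) + (mm \<tau> k - rr \<tau> (Suc k)) * nn \<tau> (Suc k)) \<and>
     (\<forall>r. infinite {k. k \<ge> 1 \<and> rr \<tau> k = r})"

definition level :: "scheme_type \<Rightarrow> omega1 set set \<Rightarrow> nat \<Rightarrow> omega1 set set" where
  "level \<tau> F k = {X \<in> F. card X = mm \<tau> k}"

definition initial_segment :: "omega1 set \<Rightarrow> omega1 set \<Rightarrow> bool" where
  "initial_segment A X \<longleftrightarrow> A \<subseteq> X \<and> (\<forall>\<beta>\<in>A. \<forall>\<alpha>\<in>X. \<alpha> < \<beta> \<longrightarrow> \<alpha> \<in> A)"

definition set_less :: "omega1 set \<Rightarrow> omega1 set \<Rightarrow> bool" where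
  "set_less A B \<longleftrightarrow> (\<forall>\<alpha>\<in>A. \<forall>\<beta>\<in>B. \<alpha> < \<beta>)"

definition root_tail_tail :: "nat \<Rightarrow> (nat \<Rightarrow> omega1 set) \<Rightarrow> omega1 set \<Rightarrow> bool" where
  "root_tail_tail n D R \<longleftrightarrow>
     (\<forall>i<n. R \<subseteq> D i \<and> set_less R (D i - R)) \<and>
     (\<forall>j<n. \<forall>i<j. D i \<inter> D j = R \<and> set_less (D i - R) (D j - R))"

text \<open>\<open>decomposition \<tau> F k X D R\<close>: the sets \<open>D 0, \<dots>, D (n\<^sub>k - 1)\<close> form the canonical
  decomposition, with root \<open>R\<close>, of the set \<open>X\<close> of level \<open>k \<ge> 1\<close>.\<close>

definition decomposition ::
  "scheme_type \<Rightarrow> omega1 set set \<Rightarrow> nat \<Rightarrow> omega1 set \<Rightarrow> (nat \<Rightarrow> omega1 set) \<Rightarrow> omega1 set \<Rightarrow> bool"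
where
  "decomposition \<tau> F k X D R \<longleftrightarrow>
     (\<forall>i<nn \<tau> k. D i \<in> level \<tau> F (k - 1)) \<and>
     X = (\<Union>i<nn \<tau> k. D i) \<and>
     root_tail_tail (nn \<tau> k) D R \<and>
     card R = rr \<tau> k"

definition construction_scheme :: "scheme_type \<Rightarrow> omega1 set set \<Rightarrow> bool" where
  "construction_scheme \<tau> F \<longleftrightarrow>
     (\<forall>X\<in>F. finite X \<and> X \<noteq> {} \<and> (\<exists>k. card X = mm \<tau> k)) \<and>
     (\<forall>A. finite A \<longrightarrow> (\<exists>X\<in>F. A \<subseteq> X)) \<and>
     (\<forall>k. \<forall>E\<in>level \<tau> F k. \<forall>X\<in>level \<tau> F k.
        initial_segment (E \<inter> X) E \<and> initial_segment (E \<inter> X) X) \<and>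
     (\<forall>k. \<forall>X\<in>level \<tau> F (Suc k). \<exists>D R. decomposition \<tau> F (Suc k) X D R)"

definition rho :: "scheme_type \<Rightarrow> omega1 set set \<Rightarrow> omega1 \<Rightarrow> omega1 \<Rightarrow> nat" where
  "rho \<tau> F \<alpha> \<beta> = (LEAST k. \<exists>X\<in>level \<tau> F k. {\<alpha>, \<beta>} \<subseteq> X)"

definition closure_at :: "scheme_type \<Rightarrow> omega1 set set \<Rightarrow> omega1 \<Rightarrow> nat \<Rightarrow> omega1 set" where
  "closure_at \<tau> F \<beta> k = {\<xi>. \<xi> \<le> \<beta> \<and> rho \<tau> F \<beta> \<xi> \<le> k}"

definition norm_at :: "scheme_type \<Rightarrow> omega1 set set \<Rightarrow> omega1 \<Rightarrow> nat \<Rightarrow> nat" where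
  "norm_at \<tau> F \<alpha> k = card (closure_at \<tau> F \<alpha> k - {\<alpha>})"

definition Delta :: "scheme_type \<Rightarrow> omega1 set set \<Rightarrow> omega1 \<Rightarrow> omega1 \<Rightarrow> nat" where
  "Delta \<tau> F \<alpha> \<beta> = (LEAST k. norm_at \<tau> F \<alpha> k \<noteq> norm_at \<tau> F \<beta> k)"

text \<open>For \<open>k \<ge> 1\<close> the value does not depend on the choice of the set \<open>X\<close> of level \<open>k\<close>
  containing \<open>\<alpha>\<close>, because two such sets intersect in an initial segment of both.\<close>

definition Xi :: "scheme_type \<Rightarrow> omega1 set set \<Rightarrow> omega1 \<Rightarrow> nat \<Rightarrow> int" where
  "Xi \<tau> F \<alpha> k =
     (if k = 0 then 0
      else THE v. \<exists>X\<in>level \<tau> F k. \<exists>D R. decomposition \<tau> F k X D R \<and>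
             (\<alpha> \<in> R \<and> v = -1 \<or> (\<exists>i<nn \<tau> k. \<alpha> \<in> D i - R \<and> v = int i)))"


section \<open>Capturing\<close>

abbreviation elt :: "omega1 set \<Rightarrow> nat \<Rightarrow> omega1" where
  "elt D a \<equiv> sorted_list_of_set D ! a"

definition captured_seq ::
  "scheme_type \<Rightarrow> omega1 set set \<Rightarrow> nat \<Rightarrow> (nat \<Rightarrow> omega1 set) \<Rightarrow> nat \<Rightarrow> bool"
where
  "captured_seq \<tau> F n D l \<longleftrightarrow>
     (\<exists>m R. (\<forall>i<n. finite (D i) \<and> card (D i) = m) \<and> root_tail_tail n D R \<and>
        (\<forall>i<n. \<forall>a<card R. Xi \<tau> F (elt (D i) a) l = -1) \<and>
        (\<forall>i<n. \<forall>a\<in>{card R..<m}. Xi \<tau> F (elt (D i) a) l = int i) \<and>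
        (\<forall>j<n. \<forall>i<j. \<forall>a\<in>{card R..<m}.
           rho \<tau> F (elt (D i) a) (elt (D j) a) = l \<and>
           Delta \<tau> F (elt (D i) a) (elt (D j) a) = l))"

definition captured_family ::
  "scheme_type \<Rightarrow> omega1 set set \<Rightarrow> nat \<Rightarrow> omega1 set set \<Rightarrow> nat \<Rightarrow> bool"
where
  "captured_family \<tau> F n \<D> l \<longleftrightarrow>
     (\<exists>D. inj_on D {..<n} \<and> \<D> = D ` {..<n} \<and> captured_seq \<tau> F n D l)"

definition captured_pair :: "scheme_type \<Rightarrow> omega1 set set \<Rightarrow> omega1 \<Rightarrow> omega1 \<Rightarrow> bool" where
  "captured_pair \<tau> F \<alpha> \<beta> \<longleftrightarrow> (\<exists>l. captured_family \<tau> F 2 {{\<alpha>}, {\<beta>}} l)"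

definition capturing :: "scheme_type \<Rightarrow> omega1 set set \<Rightarrow> nat \<Rightarrow> bool" where
  "capturing \<tau> F n \<longleftrightarrow>
     (\<forall>S. (\<forall>x\<in>S. finite x) \<and> uncountable S \<longrightarrow>
        infinite {l. \<exists>\<D>\<subseteq>S. captured_family \<tau> F n \<D> l})"


section \<open>Forcing notions\<close>

text \<open>A forcing notion is a preorder \<open>P\<close>, given as a relation with underlying set \<open>Field P\<close>;
  \<open>(q, p) \<in> P\<close> means that \<open>q\<close> is stronger than \<open>p\<close>.\<close>

definition forcing_notion :: "'p rel \<Rightarrow> bool" where
  "forcing_notion P \<longleftrightarrow> Field P \<noteq> {} \<and> Preorder P"

definition compatible :: "'p rel \<Rightarrow> 'p \<Rightarrow> 'p \<Rightarrow> bool" where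
  "compatible P p q \<longleftrightarrow> (\<exists>s. (s, p) \<in> P \<and> (s, q) \<in> P)"

definition ccc :: "'p rel \<Rightarrow> bool" where
  "ccc P \<longleftrightarrow> (\<forall>A\<subseteq>Field P. (\<forall>p\<in>A. \<forall>q\<in>A. p \<noteq> q \<longrightarrow> \<not> compatible P p q) \<longrightarrow> countable A)"

definition dense_subset :: "'p rel \<Rightarrow> 'p set \<Rightarrow> bool" where
  "dense_subset P D \<longleftrightarrow> D \<subseteq> Field P \<and> (\<forall>p\<in>Field P. \<exists>d\<in>D. (d, p) \<in> P)"

definition forcing_filter :: "'p rel \<Rightarrow> 'p set \<Rightarrow> bool" where
  "forcing_filter P G \<longleftrightarrow>
     G \<subseteq> Field P \<and> G \<noteq> {} \<and>
     (\<forall>p\<in>G. \<forall>q. (p, q) \<in> P \<longrightarrow> q \<in> G) \<and>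
     (\<forall>p\<in>G. \<forall>q\<in>G. \<exists>s\<in>G. (s, p) \<in> P \<and> (s, q) \<in> P)"

definition unmet :: "'p rel \<Rightarrow> 'p set set \<Rightarrow> bool" where
  "unmet P \<D> \<longleftrightarrow>
     (\<forall>D\<in>\<D>. dense_subset P D) \<and> \<not> (\<exists>G. forcing_filter P G \<and> (\<forall>D\<in>\<D>. G \<inter> D \<noteq> {}))"

text \<open>The least element of a nonempty set of cardinals, up to \<open>=o\<close>.\<close>

definition min_card :: "'a rel set \<Rightarrow> 'a rel" where
  "min_card C = (SOME \<kappa>. \<kappa> \<in> C \<and> (\<forall>\<mu>\<in>C. \<kappa> \<le>o \<mu>))"

text \<open>\<open>mart P\<close> is \<open>\<mm>(P)\<close>. It is only meaningful if some family of dense sets is not met by any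
  filter, which fails for example when \<open>P\<close> has a least element.\<close>

definition mart :: "'p rel \<Rightarrow> 'p set rel" where
  "mart P = min_card {|\<D>| |\<D>. unmet P \<D>}"


section \<open>The forcing relation\<close>

text \<open>
  The usual recursive definition of the forcing relation, as a shallow embedding: a formula of the
  forcing language is identified with the set of conditions forcing it, and \<open>fmem\<close>, \<open>fneg\<close>,
  \<open>fand\<close>, \<open>fall\<close> are the recursion clauses for \<open>\<in>\<close>, \<open>\<not>\<close>, \<open>\<and>\<close>, \<open>\<forall>\<close>. Only two sorts of objects of the
  extension are needed: elements \<open>x\<close> of a ground model set \<open>'x\<close>, and subsets of a ground model
  set. Every subset of \<open>'x\<close> in the extension has a name consisting of pairs \<open>(x, s)\<close> with
  \<open>x :: 'x\<close> and a condition \<open>s\<close>; so quantifying over all \<open>\<sigma> :: ('x \<times> 'p) set\<close> is quantifying over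
  all subsets of \<open>'x\<close> in the extension. (Pairs \<open>(x, s)\<close> with \<open>s \<notin> Field P\<close> have no effect.)
\<close>

definition fground :: "bool \<Rightarrow> 'p \<Rightarrow> bool" where
  "fground \<phi> p \<longleftrightarrow> \<phi>"

definition fmem :: "'p rel \<Rightarrow> 'x \<Rightarrow> ('x \<times> 'p) set \<Rightarrow> 'p \<Rightarrow> bool" where
  "fmem P x \<sigma> p \<longleftrightarrow>
     (\<forall>q. (q, p) \<in> P \<longrightarrow> (\<exists>t. (t, q) \<in> P \<and> (\<exists>s. (x, s) \<in> \<sigma> \<and> (t, s) \<in> P)))"

definition fneg :: "'p rel \<Rightarrow> ('p \<Rightarrow> bool) \<Rightarrow> 'p \<Rightarrow> bool" where
  "fneg P \<phi> p \<longleftrightarrow> (\<forall>q. (q, p) \<in> P \<longrightarrow> \<not> \<phi> q)"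

definition fand :: "('p \<Rightarrow> bool) \<Rightarrow> ('p \<Rightarrow> bool) \<Rightarrow> 'p \<Rightarrow> bool" where
  "fand \<phi> \<psi> p \<longleftrightarrow> \<phi> p \<and> \<psi> p"

definition fall :: "('x \<Rightarrow> 'p \<Rightarrow> bool) \<Rightarrow> 'p \<Rightarrow> bool" where
  "fall \<phi> p \<longleftrightarrow> (\<forall>x. \<phi> x p)"

definition fimp :: "'p rel \<Rightarrow> ('p \<Rightarrow> bool) \<Rightarrow> ('p \<Rightarrow> bool) \<Rightarrow> 'p \<Rightarrow> bool" where
  "fimp P \<phi> \<psi> = fneg P (fand \<phi> (fneg P \<psi>))"

definition fex :: "'p rel \<Rightarrow> ('x \<Rightarrow> 'p \<Rightarrow> bool) \<Rightarrow> 'p \<Rightarrow> bool" where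
  "fex P \<phi> = fneg P (fall (\<lambda>x. fneg P (\<phi> x)))"

definition forced :: "'p rel \<Rightarrow> ('p \<Rightarrow> bool) \<Rightarrow> bool" where
  "forced P \<phi> \<longleftrightarrow> (\<forall>p\<in>Field P. \<phi> p)"

text \<open>``\<open>\<sigma>\<close> is countable'': a subset \<open>f\<close> of \<open>\<omega> \<times> 'x\<close> is a partial function whose range covers
  \<open>\<sigma>\<close>.\<close>

definition fcountable :: "'p rel \<Rightarrow> ('x \<times> 'p) set \<Rightarrow> 'p \<Rightarrow> bool" where
  "fcountable P \<sigma> =
     fex P (\<lambda>f :: ((nat \<times> 'x) \<times> 'p) set.
       fand
         (fall (\<lambda>i. fall (\<lambda>x. fall (\<lambda>y.
            fimp P (fand (fmem P (i, x) f) (fmem P (i, y) f)) (fground (x = y))))))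
         (fall (\<lambda>x. fimp P (fmem P x \<sigma>) (fex P (\<lambda>i. fmem P (i, x) f)))))"

text \<open>The forcing version of \<open>capturing\<close>. Finite sets of countable ordinals, finite sets of such
  sets, and the relation ``captured at level \<open>l\<close>'' are the same in the ground model and in the
  extension, so they are ground model objects here; ccc forcing does not change \<open>\<omega>\<^sub>1\<close>. ``Infinitely
  many \<open>l\<close>'' is expressed as ``for all \<open>k\<close> some \<open>l \<ge> k\<close>''.\<close>

definition fcapturing :: "'p rel \<Rightarrow> scheme_type \<Rightarrow> omega1 set set \<Rightarrow> nat \<Rightarrow> 'p \<Rightarrow> bool" where
  "fcapturing P \<tau> F n =
     fall (\<lambda>\<sigma> :: (omega1 set \<times> 'p) set.
       fimp P
         (fand (fall (\<lambda>x. fimp P (fmem P x \<sigma>) (fground (finite x))))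
               (fneg P (fcountable P \<sigma>)))
         (fall (\<lambda>k :: nat. fex P (\<lambda>l. fand (fground (k \<le> l))
            (fex P (\<lambda>\<D>. fand
               (fall (\<lambda>x. fimp P (fground (x \<in> \<D>)) (fmem P x \<sigma>)))
               (fground (captured_family \<tau> F n \<D> l))))))))"

text \<open>\<open>mart_scheme \<tau> F\<close> is \<open>\<mm>\<^sub>F\<close>, computed with the forcing notions whose conditions are elements
  of the type \<open>'p\<close>, which plays the role of the universe of conditions. As long as \<open>'p\<close> has at
  least \<open>\<aleph>\<^sub>1\<close> elements, whether \<open>\<mm>\<^sub>F > \<omega>\<^sub>1\<close> does not depend on \<open>'p\<close>: by a Skolem hull argument
  a counterexample can be replaced by one with at most \<open>\<aleph>\<^sub>1\<close> conditions. Forcing notions with no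
  unmet family have no \<open>\<mm>(P)\<close> and do not contribute to the minimum.\<close>

definition mart_scheme :: "scheme_type \<Rightarrow> omega1 set set \<Rightarrow> 'p set rel" where
  "mart_scheme \<tau> F =
     min_card {mart P |P. forcing_notion P \<and> ccc P \<and> forced P (fcapturing P \<tau> F 2) \<and>
                          (\<exists>\<D>. unmet P \<D>)}"


section \<open>The family \<open>\<V>(F)\<close> and Ramsey ultrafilters\<close>

definition bracket :: "scheme_type \<Rightarrow> omega1 set set \<Rightarrow> omega1 \<Rightarrow> omega1 \<Rightarrow> omega1" where
  "bracket \<tau> F \<alpha> \<beta> = (LEAST \<xi>. \<xi> \<in> closure_at \<tau> F \<beta> (rho \<tau> F \<alpha> \<beta> - 1) - {..<\<alpha>})"

definition bracket_set :: "scheme_type \<Rightarrow> omega1 set set \<Rightarrow> omega1 set \<Rightarrow> omega1 set" where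
  "bracket_set \<tau> F S =
     {bracket \<tau> F \<alpha> \<beta> |\<alpha> \<beta>. \<alpha> \<in> S \<and> \<beta> \<in> S \<and> \<alpha> < \<beta> \<and> captured_pair \<tau> F \<alpha> \<beta>}"

definition VF :: "scheme_type \<Rightarrow> omega1 set set \<Rightarrow> omega1 set set" where
  "VF \<tau> F = {A. \<exists>S. uncountable S \<and> bracket_set \<tau> F S \<subseteq> A}"

definition is_ultrafilter :: "nat set set \<Rightarrow> bool" where
  "is_ultrafilter \<U> \<longleftrightarrow>
     UNIV \<in> \<U> \<and> {} \<notin> \<U> \<and>
     (\<forall>A B. A \<in> \<U> \<and> A \<subseteq> B \<longrightarrow> B \<in> \<U>) \<and>
     (\<forall>A B. A \<in> \<U> \<and> B \<in> \<U> \<longrightarrow> A \<inter> B \<in> \<U>) \<and>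
     (\<forall>A. A \<in> \<U> \<or> - A \<in> \<U>)"

definition ramsey_ultrafilter :: "nat set set \<Rightarrow> bool" where
  "ramsey_ultrafilter \<U> \<longleftrightarrow>
     is_ultrafilter \<U> \<and>
     (\<forall>\<P>. partition_on UNIV \<P> \<and> infinite \<P> \<and> \<P> \<inter> \<U> = {} \<longrightarrow>
        (\<exists>A\<in>\<U>. \<forall>X\<in>\<P>. \<forall>x\<in>A \<inter> X. \<forall>y\<in>A \<inter> X. x = y))"

end

theory Submission
  imports Defs
begin

text \<open>
  The position of an ordinal in a set of the scheme of level \<open>k + 1\<close> determines its position at level \<open>k\<close>.
  Hence if \<open>\<alpha> < \<beta>\<close> have the same position at level \<open>k\<close> and are captured at level \<open>l\<close>, then \<open>l > k\<close>, and any
  two finite subsets of their \<open>k\<close>-closures with the same positions are captured together, all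
  new pairs having the bracket of \<open>\<alpha>, \<beta>\<close>. Coding finite sets by a single ordinal and a finite set of
  positions, every uncountable family of finite sets therefore contains two amalgamable members
  whose common new bracket lies in any prescribed set with complement outside \<open>\<V>(F)\<close>. This shows
  that sets in \<open>\<V>(F)\<close> meet, and that the natural forcing for an uncountable set with
  brackets in \<open>A\<close> (or with brackets whose \<open>\<pi>\<close>-values form a partial selector) is ccc and preserves
  2-capturing, unless the complement of \<open>A\<close> is in \<open>\<V>(F)\<close>.
\<close>

section \<open>Positions in a construction scheme\<close>

text \<open>In a decomposition with blocks \<open>D 0\<close>, \<open>D 1\<close>, ... and root
  \<open>R\<close>, every pair split between the first two tails has the first point of
  \<open>D 1 - R\<close> as its bracket. An amalgamation therefore creates at most one new bracket
  value, and only this value has to be steered. Steering succeeds because every uncountable set has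
  a bracket in each set whose complement is outside V(F). The forcings for the dichotomy and for the
  selector are one construction with a parameter, a family of permitted finite sets of colours. The
  colouring is the indicator of \<open>A\<close> in the first case and \<open>\<pi>\<close> in the
  second. The countable chain condition and the preservation of 2-capturing come from the same
  amalgamation lemma, which carries along an extra finite set for each condition and captures two of
  these sets together.\<close>

lemma downward_closed_eq_lessThan:
  fixes A :: "nat set"
  assumes "\<And>a b. \<lbrakk>a \<in> A; b < a\<rbrakk> \<Longrightarrow> b \<in> A" "finite A"
  shows "A = {..<card A}"
proof (rule card_subset_eq)
  show "A \<subseteq> {..<card A}"
  proof
    fix a assume "a \<in> A"
    then have "{..a} \<subseteq> A" using assms(1) by (auto simp: le_less)
    then have "card {..a} \<le> card A" using assms(2) by (intro card_mono)
    then show "a \<in> {..<card A}" by simp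
  qed
qed auto

section \<open>Levels, closures and positions\<close>

locale scheme =
  fixes \<tau> :: scheme_type and F :: "omega1 set set"
  assumes good: "good_type \<tau>"
    and cs: "construction_scheme \<tau> F"
begin

abbreviation "m \<equiv> mm \<tau>"
abbreviation "n \<equiv> nn \<tau>"
abbreviation "r \<equiv> rr \<tau>"
abbreviation "lv \<equiv> level \<tau> F"
abbreviation "dec k X D R \<equiv> decomposition \<tau> F k X D R"
abbreviation "\<rho> \<equiv> rho \<tau> F"
abbreviation "cl \<equiv> closure_at \<tau> F"
abbreviation "nrm \<equiv> norm_at \<tau> F"

lemma n_ge_2: "2 \<le> n (Suc k)"
  and r_less_m: "r (Suc k) < m k"
  and m_Suc: "m (Suc k) = r (Suc k) + (m k - r (Suc k)) * n (Suc k)"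
  using good by (auto simp: good_type_def)

lemma two_blocks: "0 < n (Suc k)" "Suc 0 < n (Suc k)"
  using n_ge_2[of k] by auto

lemma m_less_Suc: "m k < m (Suc k)"
proof -
  have "(m k - r (Suc k)) * 2 \<le> (m k - r (Suc k)) * n (Suc k)"
    by (intro mult_le_mono le_refl n_ge_2)
  then show ?thesis using r_less_m[of k] m_Suc[of k] by linarith
qed

lemma strict_mono_m: "strict_mono m"
  by (simp add: strict_mono_Suc_iff m_less_Suc)

lemma finite_level: "X \<in> lv k \<Longrightarrow> finite X"
  and card_level: "X \<in> lv k \<Longrightarrow> card X = m k"
  using cs by (auto simp: level_def construction_scheme_def)

lemma decomposition_exists: "X \<in> lv (Suc k) \<Longrightarrow> \<exists>D R. dec (Suc k) X D R"
  using cs by (auto simp: construction_scheme_def)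

lemma initial_segment_level:
  "\<lbrakk>E \<in> lv k; X \<in> lv k; \<beta> \<in> E; \<beta> \<in> X; \<alpha> \<in> E; \<alpha> \<le> \<beta>\<rbrakk> \<Longrightarrow> \<alpha> \<in> X"
  using cs unfolding construction_scheme_def initial_segment_def
  by (metis IntD2 IntI le_less)

lemma level_below:
  assumes "X \<in> lv k" "\<alpha> \<in> X" "j \<le> k"
  obtains Z where "Z \<in> lv j" "\<alpha> \<in> Z" "Z \<subseteq> X"
proof -
  have "\<exists>Z\<in>lv j. \<alpha> \<in> Z \<and> Z \<subseteq> X"
    using assms
  proof (induction k arbitrary: X)
    case 0
    then show ?case by auto
  next
    case (Suc k)
    show ?case
    proof (cases "j = Suc k")
      case True
      then show ?thesis using Suc.prems by auto
    next
      case False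
      obtain D R where d: "dec (Suc k) X D R" using decomposition_exists Suc.prems by blast
      then obtain i where "D i \<in> lv k" "\<alpha> \<in> D i" "D i \<subseteq> X"
        using Suc.prems(2) by (auto simp: decomposition_def)
      moreover have "j \<le> k" using False Suc.prems by simp
      ultimately show ?thesis using Suc.IH[of "D i"] by blast
    qed
  qed
  then show thesis using that by blast
qed

lemma level_cofinal:
  assumes "finite A"
  obtains j X where "k \<le> j" "X \<in> lv j" "A \<subseteq> X"
proof -
  have "infinite (UNIV :: omega1 set)" using uncountable_omega1 countable_finite by blast
  \<comment> \<open>Adjoining \<open>m k\<close> points forces any covering set to have level at
    least \<open>k\<close>, because the sizes \<open>m\<close> increase strictly.\<close>
  then obtain B :: "omega1 set" where B: "finite B" "card B = m k"
    using infinite_arbitrarily_large by blast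
  obtain X where X: "X \<in> F" "A \<union> B \<subseteq> X"
    using cs assms B(1) unfolding construction_scheme_def by (metis finite_UnI)
  then obtain j where j: "X \<in> lv j"
    using cs unfolding construction_scheme_def level_def by blast
  have "m k \<le> m j" using B X(2) card_mono[OF finite_level[OF j], of B] card_level[OF j] by auto
  then have "k \<le> j" by (simp add: strict_mono_less_eq[OF strict_mono_m])
  then show thesis using that j X(2) by blast
qed

lemma level_covers: obtains X where "X \<in> lv k" "\<alpha> \<in> X"
proof -
  obtain j X where "k \<le> j" "X \<in> lv j" "{\<alpha>} \<subseteq> X"
    using level_cofinal[of "{\<alpha>}"] by blast
  then show thesis using level_below[of X j \<alpha> k] that by blast
qed

lemma rho_commute: "\<rho> \<alpha> \<beta> = \<rho> \<beta> \<alpha>"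
  by (simp add: rho_def insert_commute)

lemma rho_attained: obtains X where "X \<in> lv (\<rho> \<alpha> \<beta>)" "\<alpha> \<in> X" "\<beta> \<in> X"
proof -
  obtain j X where "X \<in> lv j" "{\<alpha>, \<beta>} \<subseteq> X"
    using level_cofinal[of "{\<alpha>, \<beta>}"] by blast
  then have "\<exists>X\<in>lv (\<rho> \<alpha> \<beta>). {\<alpha>, \<beta>} \<subseteq> X"
    unfolding rho_def by (intro LeastI[of "\<lambda>k. \<exists>X\<in>lv k. {\<alpha>, \<beta>} \<subseteq> X"]) blast
  then show thesis using that by blast
qed

text \<open>Inside \<open>X\<close> there is a set of level \<open>\<rho> \<beta> \<xi>\<close>
  around \<open>\<beta>\<close>. Below \<open>\<beta>\<close> it agrees with any other set of that
  level containing \<open>\<beta>\<close>, in particular with one that contains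
  \<open>\<xi>\<close>. Hence a single set of level \<open>j\<close> decides the bound.\<close>

lemma rho_le_iff:
  assumes "X \<in> lv j" "\<beta> \<in> X" "\<xi> \<le> \<beta>"
  shows "\<rho> \<beta> \<xi> \<le> j \<longleftrightarrow> \<xi> \<in> X"
proof
  assume "\<xi> \<in> X"
  then show "\<rho> \<beta> \<xi> \<le> j" unfolding rho_def using assms by (intro Least_le) auto
next
  assume le: "\<rho> \<beta> \<xi> \<le> j"
  obtain Y where Y: "Y \<in> lv (\<rho> \<beta> \<xi>)" "\<beta> \<in> Y" "\<xi> \<in> Y" by (rule rho_attained)
  obtain Z where "Z \<in> lv (\<rho> \<beta> \<xi>)" "\<beta> \<in> Z" "Z \<subseteq> X"
    using level_below[OF assms(1,2) le] by blast
  then show "\<xi> \<in> X" using initial_segment_level[OF Y(1) _ Y(2) _ Y(3) assms(3)] by blast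
qed

lemma closure_eq: "\<lbrakk>X \<in> lv j; \<beta> \<in> X\<rbrakk> \<Longrightarrow> cl \<beta> j = X \<inter> {..\<beta>}"
  using rho_le_iff by (auto simp: closure_at_def)

text \<open>From here on \<open>nrm \<beta> j\<close> is read as the position of
  \<open>\<beta>\<close>, counted from 0, in any set of level \<open>j\<close> containing
  it.\<close>

lemma norm_eq: "\<lbrakk>X \<in> lv j; \<beta> \<in> X\<rbrakk> \<Longrightarrow> nrm \<beta> j = card (X \<inter> {..<\<beta>})"
  unfolding norm_at_def by (rule arg_cong[where f = card]) (auto simp: closure_eq)

lemma norm_less_iff:
  assumes "X \<in> lv j" "\<alpha> \<in> X" "\<beta> \<in> X"
  shows "nrm \<alpha> j < nrm \<beta> j \<longleftrightarrow> \<alpha> < \<beta>"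
proof -
  have *: "card (X \<inter> {..<\<alpha>}) < card (X \<inter> {..<\<beta>})" if "\<alpha> < \<beta>" "\<alpha> \<in> X" for \<alpha> \<beta>
    using that finite_level[OF assms(1)] by (intro psubset_card_mono) auto
  show ?thesis
    using *[of \<alpha> \<beta>] *[of \<beta> \<alpha>] assms norm_eq[OF assms(1)] by (metis linorder_neqE not_less_iff_gr_or_eq)
qed

lemma norm_inj: "\<lbrakk>X \<in> lv j; \<alpha> \<in> X; \<beta> \<in> X; nrm \<alpha> j = nrm \<beta> j\<rbrakk> \<Longrightarrow> \<alpha> = \<beta>"
  using norm_less_iff[of X j \<alpha> \<beta>] norm_less_iff[of X j \<beta> \<alpha>] by (metis linorder_neqE less_irrefl)

lemma norm_less_m: "nrm \<alpha> j < m j"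
proof -
  obtain X where X: "X \<in> lv j" "\<alpha> \<in> X" by (rule level_covers)
  have "card (X \<inter> {..<\<alpha>}) < card X"
    using X finite_level by (intro psubset_card_mono) auto
  then show ?thesis using X norm_eq card_level by simp
qed

lemma norm_surj:
  assumes "X \<in> lv j" "p < m j"
  obtains \<alpha> where "\<alpha> \<in> X" "nrm \<alpha> j = p"
proof -
  have "(\<lambda>\<alpha>. nrm \<alpha> j) ` X = {..<m j}"
  proof (rule card_subset_eq)
    have "inj_on (\<lambda>\<alpha>. nrm \<alpha> j) X" using norm_inj[OF assms(1)] by (auto simp: inj_on_def)
    then show "card ((\<lambda>\<alpha>. nrm \<alpha> j) ` X) = card {..<m j}"
      by (simp add: card_image card_level[OF assms(1)])
  qed (auto simp: norm_less_m)
  then show thesis using assms(2) that by (metis imageE lessThan_iff)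
qed

section \<open>Positions inside a canonical decomposition\<close>

context
  fixes k X D R
  assumes dec: "dec (Suc k) X D R"
begin

lemma dec_level: "i < n (Suc k) \<Longrightarrow> D i \<in> lv k"
  and dec_Union: "X = (\<Union>i<n (Suc k). D i)"
  and dec_card_root: "card R = r (Suc k)"
  and dec_root: "i < n (Suc k) \<Longrightarrow> R \<subseteq> D i"
  and dec_root_less: "\<lbrakk>i < n (Suc k); \<alpha> \<in> R; \<beta> \<in> D i; \<beta> \<notin> R\<rbrakk> \<Longrightarrow> \<alpha> < \<beta>"
  and dec_Int: "\<lbrakk>i < j; j < n (Suc k)\<rbrakk> \<Longrightarrow> D i \<inter> D j = R"
  and dec_less: "\<lbrakk>i < j; j < n (Suc k); \<alpha> \<in> D i - R; \<beta> \<in> D j - R\<rbrakk> \<Longrightarrow> \<alpha> < \<beta>"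
  using dec by (auto simp: decomposition_def root_tail_tail_def set_less_def)

lemma dec_finite: "i < n (Suc k) \<Longrightarrow> finite (D i)" "finite R"
  using finite_level[OF dec_level] finite_subset[OF dec_root[of 0]] n_ge_2[of k] by auto

lemma dec_card_tail: "i < n (Suc k) \<Longrightarrow> card (D i - R) = m k - r (Suc k)"
  using card_Diff_subset[OF dec_finite(2) dec_root] card_level[OF dec_level] dec_card_root by simp

lemma norm_root:
  assumes "\<alpha> \<in> R"
  shows "nrm \<alpha> k < r (Suc k)"
proof -
  have i: "0 < n (Suc k)" using n_ge_2[of k] by simp
  have "nrm \<alpha> k = card (D 0 \<inter> {..<\<alpha>})"
    using norm_eq[OF dec_level[OF i]] assms dec_root[OF i] by auto
  also have "\<dots> < card R"
  proof (rule psubset_card_mono[OF dec_finite(2)])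
    have "D 0 \<inter> {..<\<alpha>} \<subseteq> R" using dec_root_less[OF i assms] by fastforce
    then show "D 0 \<inter> {..<\<alpha>} \<subset> R" using assms by auto
  qed
  finally show ?thesis by (simp add: dec_card_root)
qed

lemma norm_tail:
  assumes "i < n (Suc k)" "\<alpha> \<in> D i - R"
  shows "r (Suc k) \<le> nrm \<alpha> k"
proof -
  have "R \<subseteq> D i \<inter> {..<\<alpha>}" using dec_root dec_root_less assms by auto
  then have "card R \<le> card (D i \<inter> {..<\<alpha>})" using assms dec_finite(1) by (intro card_mono) auto
  then show ?thesis using norm_eq[OF dec_level] assms dec_card_root by simp
qed

lemma norm_Suc_root:
  assumes "\<alpha> \<in> R" "X \<in> lv (Suc k)"
  shows "nrm \<alpha> (Suc k) = nrm \<alpha> k"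
proof -
  have i: "0 < n (Suc k)" using n_ge_2[of k] by simp
  have "X \<inter> {..<\<alpha>} = D 0 \<inter> {..<\<alpha>}"
    using dec_root_less[OF _ assms(1)] dec_root[OF i] dec_Union i by fastforce
  moreover have "\<alpha> \<in> X" "\<alpha> \<in> D 0" using assms dec_root[OF i] dec_Union i by auto
  ultimately show ?thesis using norm_eq[OF assms(2)] norm_eq[OF dec_level[OF i]] by simp
qed

text \<open>Below a point of the tail of block \<open>i\<close> lie the \<open>i\<close> earlier
  tails, each of size \<open>m k - r (Suc k)\<close>, and an initial part of its own block. The root
  belongs to that part, so it is counted once, in \<open>nrm \<alpha> k\<close>.\<close>

lemma norm_Suc_tail:
  assumes "i < n (Suc k)" "\<alpha> \<in> D i - R" "X \<in> lv (Suc k)"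
  shows "nrm \<alpha> (Suc k) = i * (m k - r (Suc k)) + nrm \<alpha> k"
proof -
  have X: "X \<inter> {..<\<alpha>} = (\<Union>j<i. D j - R) \<union> (D i \<inter> {..<\<alpha>})" (is "?L = ?A \<union> ?B")
  proof (intro equalityI subsetI)
    fix \<xi> assume \<xi>: "\<xi> \<in> ?L"
    then obtain j where j: "j < n (Suc k)" "\<xi> \<in> D j" "\<xi> < \<alpha>" using dec_Union by auto
    show "\<xi> \<in> ?A \<union> ?B"
    proof (cases "\<xi> \<in> R")
      case True
      then show ?thesis using dec_root assms(1) \<xi> by auto
    next
      case False
      then have "\<not> i < j" using dec_less[of i j \<alpha> \<xi>] j assms by auto
      then show ?thesis using j False by (cases "i = j") auto
    qed
  next
    fix \<xi> assume "\<xi> \<in> ?A \<union> ?B"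
    then show "\<xi> \<in> ?L" using dec_less[of _ i \<xi> \<alpha>] assms dec_Union by fastforce
  qed
  have "card ?A = (\<Sum>j<i. card (D j - R))"
    using dec_Int assms(1) dec_finite(1)
    by (intro card_UN_disjoint) (auto, metis IntI linorder_neqE_nat order_less_trans)
  also have "\<dots> = i * (m k - r (Suc k))" using assms(1) by (simp add: dec_card_tail)
  finally have A: "card ?A = i * (m k - r (Suc k))" .
  have "?A \<inter> ?B = {}" using dec_Int[of _ i] assms(1) by blast
  then have "card ?L = card ?A + card ?B"
    unfolding X using dec_finite(1) assms(1) by (intro card_Un_disjoint) auto
  moreover have "\<alpha> \<in> X" "\<alpha> \<in> D i" using assms dec_Union by auto
  ultimately show ?thesis using A norm_eq[OF assms(3)] norm_eq[OF dec_level] assms(1) by simp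
qed

lemma dec_mem_root_iff: "\<lbrakk>\<alpha> \<in> X; X \<in> lv (Suc k)\<rbrakk> \<Longrightarrow> \<alpha> \<in> R \<longleftrightarrow> nrm \<alpha> (Suc k) < r (Suc k)"
  using norm_root norm_Suc_root norm_Suc_tail norm_tail dec_Union
  by (metis DiffI UN_E lessThan_iff linorder_not_less trans_le_add2)

text \<open>Once the root is subtracted, \<open>norm_Suc_tail\<close> is a division with remainder:
  the quotient is the index of the block, the remainder the place within its tail.\<close>

lemma dec_mem_tail_iff:
  assumes "i < n (Suc k)" "\<alpha> \<in> X" "X \<in> lv (Suc k)"
  shows "\<alpha> \<in> D i - R \<longleftrightarrow> r (Suc k) \<le> nrm \<alpha> (Suc k) \<and>
    (nrm \<alpha> (Suc k) - r (Suc k)) div (m k - r (Suc k)) = i"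
proof -
  have *: "r (Suc k) \<le> nrm \<alpha> (Suc k) \<and> (nrm \<alpha> (Suc k) - r (Suc k)) div (m k - r (Suc k)) = j"
    if j: "j < n (Suc k)" "\<alpha> \<in> D j - R" for j
  proof -
    have "nrm \<alpha> (Suc k) - r (Suc k) = j * (m k - r (Suc k)) + (nrm \<alpha> k - r (Suc k))"
      using norm_Suc_tail[OF j assms(3)] norm_tail[OF j] by simp
    moreover have "nrm \<alpha> k - r (Suc k) < m k - r (Suc k)"
      using norm_less_m[of \<alpha> k] norm_tail[OF j] by simp
    ultimately have "(nrm \<alpha> (Suc k) - r (Suc k)) div (m k - r (Suc k)) = j" by simp
    then show ?thesis using norm_Suc_tail[OF j assms(3)] norm_tail[OF j] by simp
  qed
  show ?thesis
  proof (cases "\<alpha> \<in> R")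
    case True
    then show ?thesis using dec_mem_root_iff assms by auto
  next
    case False
    then obtain j where j: "j < n (Suc k)" "\<alpha> \<in> D j - R" using assms dec_Union by auto
    show ?thesis using *[OF j] *[OF assms(1)] j by auto
  qed
qed

end

text \<open>This is the remainder of the same division. The formula mentions no decomposition, so it
  allows ordinals from unrelated sets to be compared.\<close>

lemma norm_step:
  "nrm \<alpha> k = (if nrm \<alpha> (Suc k) < r (Suc k) then nrm \<alpha> (Suc k)
     else r (Suc k) + (nrm \<alpha> (Suc k) - r (Suc k)) mod (m k - r (Suc k)))"
proof -
  obtain X where X: "X \<in> lv (Suc k)" "\<alpha> \<in> X" by (rule level_covers)
  obtain D R where d: "dec (Suc k) X D R" using decomposition_exists[OF X(1)] by blast
  show ?thesis
  proof (cases "\<alpha> \<in> R")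
    case True
    then show ?thesis using norm_Suc_root[OF d True X(1)] dec_mem_root_iff[OF d X(2,1)] by simp
  next
    case False
    then obtain i where i: "i < n (Suc k)" "\<alpha> \<in> D i - R" using X(2) dec_Union[OF d] by auto
    have "nrm \<alpha> (Suc k) - r (Suc k) = i * (m k - r (Suc k)) + (nrm \<alpha> k - r (Suc k))"
      using norm_Suc_tail[OF d i X(1)] norm_tail[OF d i] by simp
    moreover have "nrm \<alpha> k - r (Suc k) < m k - r (Suc k)"
      using norm_less_m[of \<alpha> k] norm_tail[OF d i] by simp
    ultimately have "(nrm \<alpha> (Suc k) - r (Suc k)) mod (m k - r (Suc k)) = nrm \<alpha> k - r (Suc k)"
      by simp
    then show ?thesis
      using False dec_mem_root_iff[OF d X(2,1)] norm_tail[OF d i] by simp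
  qed
qed

lemma norm_eq_below: "\<lbrakk>nrm \<alpha> k = nrm \<beta> k; j \<le> k\<rbrakk> \<Longrightarrow> nrm \<alpha> j = nrm \<beta> j"
proof (induction k)
  case (Suc k)
  then show ?case using norm_step[of \<alpha> k] norm_step[of \<beta> k] by (cases "j = Suc k") auto
qed auto

text \<open>Every decomposition of every set of this level around \<open>\<alpha>\<close> must place
  it according to its position. Hence the definite description denotes, and \<open>Xi\<close>
  becomes a function of the position alone.\<close>

lemma Xi_Suc:
  "Xi \<tau> F \<alpha> (Suc k) = (if nrm \<alpha> (Suc k) < r (Suc k) then -1
     else int ((nrm \<alpha> (Suc k) - r (Suc k)) div (m k - r (Suc k))))" (is "_ = ?v")
proof -
  let ?P = "\<lambda>v X D R. dec (Suc k) X D R \<and>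
    (\<alpha> \<in> R \<and> v = -1 \<or> (\<exists>i<n (Suc k). \<alpha> \<in> D i - R \<and> v = int i))"
  have uniq: "v = ?v" if P: "X \<in> lv (Suc k)" "?P v X D R" for v X D R
  proof -
    have d: "dec (Suc k) X D R" using P(2) by blast
    have \<alpha>: "\<alpha> \<in> X" using P(2) dec_Union[OF d] dec_root[OF d, of 0] n_ge_2[of k] by fastforce
    from P(2) show ?thesis
      using dec_mem_root_iff[OF d \<alpha> P(1)] dec_mem_tail_iff[OF d _ \<alpha> P(1)] by auto
  qed
  obtain X where X: "X \<in> lv (Suc k)" "\<alpha> \<in> X" by (rule level_covers)
  obtain D R where d: "dec (Suc k) X D R" using decomposition_exists[OF X(1)] by blast
  have "\<exists>v. ?P v X D R" using d X(2) dec_Union[OF d] by auto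
  then have "\<exists>v. \<exists>X\<in>lv (Suc k). \<exists>D R. ?P v X D R" using X(1) by blast
  then have "(THE v. \<exists>X\<in>lv (Suc k). \<exists>D R. ?P v X D R) = ?v"
    using uniq by (intro the_equality) metis+
  then show ?thesis by (simp add: Xi_def)
qed

text \<open>Descent from \<open>l\<close> to \<open>k\<close>: above level \<open>k\<close>, a pair
  with \<open>\<rho>\<close> at most \<open>k\<close> lies in a single block of \<open>X\<close>,
  and equal positions put the other pair into the block of the same index in \<open>Y\<close>. At
  level \<open>k\<close>, membership in a common set is the claim.\<close>

lemma rho_homogeneous:
  assumes "k \<le> l" "X \<in> lv l" "\<xi> \<in> X" "\<alpha> \<in> X" "\<xi> \<le> \<alpha>" "\<rho> \<alpha> \<xi> \<le> k"
    and "Y \<in> lv l" "\<xi>' \<in> Y" "\<alpha>' \<in> Y" "nrm \<xi> l = nrm \<xi>' l" "nrm \<alpha> l = nrm \<alpha>' l"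
  shows "\<rho> \<alpha>' \<xi>' \<le> k"
  using assms
proof (induction l arbitrary: X Y)
  have le: "\<xi>' \<le> \<alpha>'" if "X \<in> lv l" "\<xi> \<in> X" "\<alpha> \<in> X" "\<xi> \<le> \<alpha>" "Y \<in> lv l" "\<xi>' \<in> Y" "\<alpha>' \<in> Y"
      "nrm \<xi> l = nrm \<xi>' l" "nrm \<alpha> l = nrm \<alpha>' l" for X Y l
    using norm_less_iff[of X l \<alpha> \<xi>] norm_less_iff[of Y l \<alpha>' \<xi>'] that by (metis linorder_not_less)
  {
    case 0
    then show ?case using rho_le_iff[of Y 0 \<alpha>' \<xi>'] le[of X 0 Y] by simp
  next
    case (Suc l)
    show ?case
    proof (cases "k = Suc l")
      case True
      then show ?thesis using rho_le_iff[of Y "Suc l" \<alpha>' \<xi>'] le[of X "Suc l" Y] Suc.prems by simp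
    next
      case False
      then have k: "k \<le> l" using Suc.prems by simp
      obtain D R where d: "dec (Suc l) X D R" using decomposition_exists Suc.prems by blast
      obtain D' R' where d': "dec (Suc l) Y D' R'" using decomposition_exists Suc.prems by blast
      have root: "\<xi> \<in> R \<longleftrightarrow> \<xi>' \<in> R'" "\<alpha> \<in> R \<longleftrightarrow> \<alpha>' \<in> R'"
        using dec_mem_root_iff[OF d] dec_mem_root_iff[OF d'] Suc.prems by simp_all
      have tail: "\<xi> \<in> D i - R \<longleftrightarrow> \<xi>' \<in> D' i - R'" "\<alpha> \<in> D i - R \<longleftrightarrow> \<alpha>' \<in> D' i - R'"
        if "i < n (Suc l)" for i
        using dec_mem_tail_iff[OF d that] dec_mem_tail_iff[OF d' that] Suc.prems by simp_all
      obtain i where i: "i < n (Suc l)" "\<alpha> \<in> D i"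
        using Suc.prems dec_Union[OF d] by auto
      have "\<xi> \<in> D i"
        using rho_le_iff[OF dec_level[OF d i(1)] i(2), of \<xi>] Suc.prems k by simp
      moreover have "\<xi>' \<in> D' i" "\<alpha>' \<in> D' i"
        using root tail[OF i(1)] i(2) \<open>\<xi> \<in> D i\<close> dec_root[OF d' i(1)] by blast+
      moreover have "nrm \<xi> l = nrm \<xi>' l" "nrm \<alpha> l = nrm \<alpha>' l"
        using norm_eq_below[OF Suc.prems(10), of l] norm_eq_below[OF Suc.prems(11), of l] by simp_all
      ultimately show ?thesis
        using Suc.IH[OF k dec_level[OF d i(1)] _ i(2) Suc.prems(5,6) dec_level[OF d' i(1)]] by blast
    qed
  }
qed

section \<open>Captured pairs and their brackets\<close>

definition captured_at :: "nat \<Rightarrow> omega1 \<Rightarrow> omega1 \<Rightarrow> bool" where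
  "captured_at l \<alpha> \<beta> \<longleftrightarrow> \<alpha> < \<beta> \<and> Xi \<tau> F \<alpha> l = 0 \<and> Xi \<tau> F \<beta> l = 1 \<and> \<rho> \<alpha> \<beta> = l \<and> Delta \<tau> F \<alpha> \<beta> = l"

text \<open>Two distinct singletons have empty root, and the order of the tails makes the smaller
  ordinal the first member of the family.\<close>

lemma captured_at_if_captured_family:
  assumes "captured_family \<tau> F 2 {{\<alpha>}, {\<beta>}} l" "\<alpha> < \<beta>"
  shows "captured_at l \<alpha> \<beta>"
proof -
  obtain D where D: "{{\<alpha>}, {\<beta>}} = D ` {..<2}" and c: "captured_seq \<tau> F 2 D l"
    using assms(1) by (auto simp: captured_family_def)
  have D: "{{\<alpha>}, {\<beta>}} = {D 0, D 1}" unfolding D by (auto simp: numeral_2_eq_2 lessThan_Suc)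
  obtain c R where
    card: "\<And>i. i < 2 \<Longrightarrow> card (D i) = c"
    and rtt: "root_tail_tail 2 D R"
    and Xi: "\<And>i a. \<lbrakk>i < 2; a \<in> {card R..<c}\<rbrakk> \<Longrightarrow> Xi \<tau> F (elt (D i) a) l = int i"
    and rd: "\<And>a. a \<in> {card R..<c} \<Longrightarrow>
        \<rho> (elt (D 0) a) (elt (D 1) a) = l \<and> Delta \<tau> F (elt (D 0) a) (elt (D 1) a) = l"
  proof -
    obtain c R where "(\<forall>i<2. finite (D i) \<and> card (D i) = c) \<and> root_tail_tail 2 D R \<and>
        (\<forall>i<2. \<forall>a<card R. Xi \<tau> F (elt (D i) a) l = -1) \<and>
        (\<forall>i<2. \<forall>a\<in>{card R..<c}. Xi \<tau> F (elt (D i) a) l = int i) \<and>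
        (\<forall>j<2. \<forall>i<j. \<forall>a\<in>{card R..<c}. \<rho> (elt (D i) a) (elt (D j) a) = l \<and>
           Delta \<tau> F (elt (D i) a) (elt (D j) a) = l)"
      using c unfolding captured_seq_def by blast
    then show thesis by (intro that[of c R]) auto
  qed
  have rtt': "D 0 \<inter> D 1 = R" "set_less (D 0 - R) (D 1 - R)"
    using rtt unfolding root_tail_tail_def by (metis one_less_numeral_iff semiring_norm(76) zero_less_one)+
  have D_cases: "D 0 = {\<alpha>} \<and> D 1 = {\<beta>} \<or> D 0 = {\<beta>} \<and> D 1 = {\<alpha>}"
    using D by (metis doubleton_eq_iff)
  then have R: "R = {}" using rtt'(1) assms(2) by auto
  have D01: "D 0 = {\<alpha>}" "D 1 = {\<beta>}"
    using D_cases rtt'(2) R assms(2) by (auto simp: set_less_def)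
  have "c = 1" using card[of 0] D01 by simp
  then show ?thesis
    using Xi[of 0 0] Xi[of 1 0] rd[of 0] assms(2) unfolding R D01 captured_at_def by simp
qed

text \<open>Up to level \<open>k\<close> the positions agree, so \<open>Xi\<close> takes the same
  value on both ordinals there, whereas capture requires the values 0 and 1.\<close>

lemma captured_at_level_gt:
  assumes "captured_at l \<alpha> \<beta>" "nrm \<alpha> k = nrm \<beta> k"
  shows "k < l"
proof (rule ccontr)
  assume "\<not> k < l"
  then have "nrm \<alpha> l = nrm \<beta> l" using norm_eq_below[OF assms(2), of l] by linarith
  then have "Xi \<tau> F \<alpha> l = Xi \<tau> F \<beta> l"
    by (cases l) (simp_all add: Xi_Suc Xi_def[of _ _ _ 0])
  then show False using assms(1) unfolding captured_at_def by (metis zero_neq_one)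
qed

text \<open>Level 0 is impossible because \<open>Xi\<close> is constantly 0 there. At level
  \<open>Suc k\<close>, the condition on \<open>Delta\<close> yields equal positions at
  \<open>k\<close>, so a captured pair occupies corresponding places in the tails of blocks 0 and
  1.\<close>

lemma captured_at_decomposition:
  assumes "captured_at l \<alpha> \<beta>"
  obtains k X D R where "l = Suc k" "X \<in> lv (Suc k)" "dec (Suc k) X D R"
    "\<alpha> \<in> D 0 - R" "\<beta> \<in> D 1 - R" "nrm \<alpha> k = nrm \<beta> k"
proof -
  obtain X where X: "X \<in> lv l" "\<alpha> \<in> X" "\<beta> \<in> X"
    using rho_attained[of \<alpha> \<beta>] assms by (auto simp: captured_at_def)
  obtain k where k: "l = Suc k"
    using assms by (cases l) (auto simp: captured_at_def Xi_def)
  obtain D R where d: "dec (Suc k) X D R" using decomposition_exists X k by blast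
  have "nrm \<alpha> k = nrm \<beta> k"
    using not_less_Least[of k "\<lambda>k. nrm \<alpha> k \<noteq> nrm \<beta> k"] assms k by (simp add: captured_at_def Delta_def)
  moreover have "\<alpha> \<in> D 0 - R" "\<beta> \<in> D 1 - R"
    using assms X dec_mem_tail_iff[OF d, of 0 \<alpha>] dec_mem_tail_iff[OF d, of 1 \<beta>] n_ge_2[of k]
    unfolding captured_at_def k Xi_Suc by (simp_all split: if_splits)
  ultimately show thesis using that X d k by blast
qed

context
  fixes k X D R
  assumes X: "X \<in> lv (Suc k)" and d: "dec (Suc k) X D R"
begin

lemma rho_tails:
  assumes "\<xi> \<in> D 0 - R" "\<zeta> \<in> D 1 - R"
  shows "\<rho> \<xi> \<zeta> = Suc k"
proof -
  have *: "\<xi> < \<zeta>" "\<xi> \<in> X" "\<zeta> \<in> X" "\<xi> \<notin> D 1"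
    using assms dec_less[OF d, of 0 1] dec_Union[OF d] dec_Int[OF d, of 0 1] two_blocks by auto
  have "\<rho> \<zeta> \<xi> \<le> Suc k" "\<not> \<rho> \<zeta> \<xi> \<le> k"
    using rho_le_iff[OF X] rho_le_iff[OF dec_level[OF d], of 1 \<zeta> \<xi>] * assms two_blocks by auto
  then show ?thesis using rho_commute by simp
qed

text \<open>A converse of \<open>captured_at_decomposition\<close>. Positions agree up to level
  \<open>k\<close> and differ at \<open>Suc k\<close>, since distinct points of \<open>X\<close>
  have distinct positions in it.\<close>

lemma captured_at_tails:
  assumes "\<xi> \<in> D 0 - R" "\<zeta> \<in> D 1 - R" "nrm \<xi> k = nrm \<zeta> k"
  shows "captured_at (Suc k) \<xi> \<zeta>"
proof -
  have *: "\<xi> < \<zeta>" "\<xi> \<in> X" "\<zeta> \<in> X"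
    using assms dec_less[OF d, of 0 1] dec_Union[OF d] two_blocks by auto
  have Xi: "Xi \<tau> F \<xi> (Suc k) = 0" "Xi \<tau> F \<zeta> (Suc k) = 1"
    using assms dec_mem_tail_iff[OF d _ _ X, of 0 \<xi>] dec_mem_tail_iff[OF d _ _ X, of 1 \<zeta>] two_blocks *
    by (auto simp: Xi_Suc)
  have "Delta \<tau> F \<xi> \<zeta> = Suc k"
    unfolding Delta_def
  proof (rule Least_equality)
    show "nrm \<xi> (Suc k) \<noteq> nrm \<zeta> (Suc k)" using norm_inj[OF X] * by auto
    show "Suc k \<le> j" if "nrm \<xi> j \<noteq> nrm \<zeta> j" for j
      using norm_eq_below[OF assms(3)] that not_less_eq_eq by blast
  qed
  then show ?thesis using * Xi rho_tails assms by (simp add: captured_at_def)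
qed

text \<open>The \<open>k\<close>-closure of \<open>\<zeta>\<close> is the part of \<open>D 1\<close>
  up to \<open>\<zeta>\<close>. Removing the points below \<open>\<xi>\<close> deletes exactly the
  root, since \<open>\<xi>\<close> lies above \<open>R\<close> and below the whole tail of
  \<open>D 1\<close>. Neither capture nor equal positions are involved.\<close>

lemma bracket_tails:
  assumes "\<xi> \<in> D 0 - R" "\<zeta> \<in> D 1 - R"
  shows "bracket \<tau> F \<xi> \<zeta> = (LEAST \<eta>. \<eta> \<in> D 1 - R)"
proof -
  let ?\<mu> = "LEAST \<eta>. \<eta> \<in> D 1 - R"
  have \<mu>: "?\<mu> \<in> D 1 - R" "?\<mu> \<le> \<zeta>"
    using LeastI[of "\<lambda>\<eta>. \<eta> \<in> D 1 - R"] Least_le[of "\<lambda>\<eta>. \<eta> \<in> D 1 - R"] assms(2) by blast+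
  have cl: "cl \<zeta> k = D 1 \<inter> {..\<zeta>}" using closure_eq dec_level[OF d] assms(2) two_blocks by auto
  have "(LEAST \<eta>. \<eta> \<in> cl \<zeta> k - {..<\<xi>}) = ?\<mu>"
  proof (rule Least_equality)
    show "?\<mu> \<in> cl \<zeta> k - {..<\<xi>}"
      using dec_less[OF d, of 0 1 \<xi> ?\<mu>] \<mu> assms two_blocks cl by auto
    show "?\<mu> \<le> \<eta>" if "\<eta> \<in> cl \<zeta> k - {..<\<xi>}" for \<eta>
      using that dec_root_less[OF d, of 0 \<eta> \<xi>] assms two_blocks[of k] cl by (intro Least_le) fastforce
  qed
  then show ?thesis by (simp add: bracket_def rho_tails[OF assms])
qed

text \<open>Lifts an equality of positions from the low level \<open>j\<close> to the level
  \<open>k\<close> just below the capture, where positions decide membership in the root.\<close>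

lemma norm_transfer:
  assumes "\<alpha> \<in> D 0 - R" "\<beta> \<in> D 1 - R" "nrm \<alpha> k = nrm \<beta> k" "j \<le> k"
    and "\<xi> \<in> cl \<alpha> j" "\<zeta> \<in> cl \<beta> j" "nrm \<xi> j = nrm \<zeta> j"
  shows "\<xi> \<in> D 0" "\<zeta> \<in> D 1" "nrm \<xi> k = nrm \<zeta> k" "\<xi> \<in> R \<longleftrightarrow> \<zeta> \<in> R" "\<xi> \<in> R \<Longrightarrow> \<zeta> = \<xi>"
proof -
  have D: "D 0 \<in> lv k" "D 1 \<in> lv k" using dec_level[OF d] two_blocks by auto
  have \<xi>: "\<xi> \<le> \<alpha>" "\<rho> \<alpha> \<xi> \<le> j" and \<zeta>: "\<zeta> \<le> \<beta>" "\<rho> \<beta> \<zeta> \<le> j"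
    using assms by (auto simp: closure_at_def)
  show 0: "\<xi> \<in> D 0" and 1: "\<zeta> \<in> D 1"
    using rho_le_iff[OF D(1), of \<alpha> \<xi>] rho_le_iff[OF D(2), of \<beta> \<zeta>] \<xi> \<zeta> assms(1,2,4) by auto
  \<comment> \<open>\<open>\<zeta>'\<close> is the point of block 1 corresponding to
    \<open>\<xi>\<close> at level \<open>k\<close>. Homogeneity of \<open>\<rho>\<close> puts it
    into the \<open>j\<close>-closure of \<open>\<beta>\<close>, where positions at level
    \<open>j\<close> are distinct, so it must be \<open>\<zeta>\<close>.\<close>
  obtain \<zeta>' where \<zeta>': "\<zeta>' \<in> D 1" "nrm \<zeta>' k = nrm \<xi> k"
    using norm_surj[OF D(2) norm_less_m] by blast
  have "\<zeta>' \<le> \<beta>"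
    using norm_less_iff[OF D(1), of \<alpha> \<xi>] norm_less_iff[OF D(2), of \<beta> \<zeta>'] assms 0 \<xi> \<zeta>'
    by (metis DiffD1 linorder_not_less)
  moreover have "\<rho> \<beta> \<zeta>' \<le> j"
    using rho_homogeneous[OF assms(4) D(1) 0 _ \<xi> D(2) \<zeta>'(1)] \<zeta>' assms by auto
  ultimately have "\<zeta>' \<in> cl \<beta> j" by (simp add: closure_at_def)
  moreover obtain Z where "Z \<in> lv j" "\<beta> \<in> Z" by (rule level_covers)
  moreover have "nrm \<zeta>' j = nrm \<zeta> j" using norm_eq_below[OF \<zeta>'(2) assms(4)] assms(7) by simp
  ultimately have "\<zeta>' = \<zeta>" using assms(6) norm_inj[of Z j \<zeta>' \<zeta>] closure_eq[of Z j \<beta>] by auto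
  then show eq: "nrm \<xi> k = nrm \<zeta> k" using \<zeta>' by simp
  show R: "\<xi> \<in> R \<longleftrightarrow> \<zeta> \<in> R"
    using norm_root[OF d] norm_tail[OF d, of 0 \<xi>] norm_tail[OF d, of 1 \<zeta>] eq 0 1 two_blocks
    by (metis DiffI One_nat_def linorder_not_less)
  show "\<zeta> = \<xi>" if "\<xi> \<in> R"
    using norm_inj[OF D(1), of \<zeta> \<xi>] that R eq 0 dec_root[OF d two_blocks(1)] by auto
qed

end

lemma cl_subset_level: obtains Z where "Z \<in> lv k" "cl \<alpha> k \<subseteq> Z"
proof -
  obtain Z where "Z \<in> lv k" "\<alpha> \<in> Z" by (rule level_covers)
  then show thesis using that closure_eq by auto
qed

lemma captured_at_transfer:
  assumes "captured_at l \<alpha> \<beta>" "nrm \<alpha> k = nrm \<beta> k"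
    and "\<xi> \<in> cl \<alpha> k" "\<zeta> \<in> cl \<beta> k" "nrm \<xi> k = nrm \<zeta> k" "\<xi> \<noteq> \<zeta>"
  shows "captured_at l \<xi> \<zeta>" "bracket \<tau> F \<xi> \<zeta> = bracket \<tau> F \<alpha> \<beta>"
proof -
  obtain j X D R where l: "l = Suc j" and X: "X \<in> lv (Suc j)" and d: "dec (Suc j) X D R"
    and \<alpha>\<beta>: "\<alpha> \<in> D 0 - R" "\<beta> \<in> D 1 - R" "nrm \<alpha> j = nrm \<beta> j"
    using captured_at_decomposition[OF assms(1)] by blast
  have "k \<le> j" using captured_at_level_gt[OF assms(1,2)] l by simp
  note * = norm_transfer[OF X d \<alpha>\<beta> this assms(3-5)]
  \<comment> \<open>In the root, corresponding points coincide, so distinct ones lie in the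
    tails.\<close>
  have "\<xi> \<in> D 0 - R" "\<zeta> \<in> D 1 - R" using * assms(6) by auto
  then show "captured_at l \<xi> \<zeta>" "bracket \<tau> F \<xi> \<zeta> = bracket \<tau> F \<alpha> \<beta>"
    using captured_at_tails[OF X d _ _ *(3)] bracket_tails[OF X d] \<alpha>\<beta> l by simp_all
qed

text \<open>Only pairs split between \<open>p - q\<close> and \<open>q - p\<close> are new. Since
  \<open>p\<close> and \<open>q\<close> have the same trace on the root, such a pair is split
  between tails 0 and 1 and falls under \<open>bracket_tails\<close>, whatever its
  positions.\<close>

lemma bracket_set_Un:
  assumes "captured_at l \<alpha> \<beta>" "nrm \<alpha> k = nrm \<beta> k" "p \<subseteq> cl \<alpha> k" "q \<subseteq> cl \<beta> k"
    and pq: "(\<lambda>\<xi>. nrm \<xi> k) ` p = (\<lambda>\<xi>. nrm \<xi> k) ` q"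
  shows "bracket_set \<tau> F (p \<union> q) \<subseteq> insert (bracket \<tau> F \<alpha> \<beta>) (bracket_set \<tau> F p \<union> bracket_set \<tau> F q)"
proof -
  obtain j X D R where l: "l = Suc j" and X: "X \<in> lv (Suc j)" and d: "dec (Suc j) X D R"
    and \<alpha>\<beta>: "\<alpha> \<in> D 0 - R" "\<beta> \<in> D 1 - R" "nrm \<alpha> j = nrm \<beta> j"
    using captured_at_decomposition[OF assms(1)] by blast
  have k: "k \<le> j" using captured_at_level_gt[OF assms(1,2)] l by simp
  have p: "\<xi> \<in> D 0 \<and> (\<xi> \<in> R \<longrightarrow> \<xi> \<in> q)" if \<xi>: "\<xi> \<in> p" for \<xi>
  proof -
    have "nrm \<xi> k \<in> (\<lambda>\<xi>. nrm \<xi> k) ` q" using \<xi> pq by blast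
    then obtain \<zeta> where \<zeta>: "\<zeta> \<in> q" "nrm \<xi> k = nrm \<zeta> k" by blast
    have "\<xi> \<in> cl \<alpha> k" "\<zeta> \<in> cl \<beta> k" using \<xi> \<zeta> assms(3,4) by blast+
    from norm_transfer(1,5)[OF X d \<alpha>\<beta> k this \<zeta>(2)] show ?thesis using \<zeta>(1) by blast
  qed
  have q: "\<zeta> \<in> D 1 \<and> (\<zeta> \<in> R \<longrightarrow> \<zeta> \<in> p)" if \<zeta>: "\<zeta> \<in> q" for \<zeta>
  proof -
    have "nrm \<zeta> k \<in> (\<lambda>\<xi>. nrm \<xi> k) ` p" using \<zeta> pq by blast
    then obtain \<xi> where \<xi>: "\<xi> \<in> p" "nrm \<xi> k = nrm \<zeta> k" by fastforce
    have "\<xi> \<in> cl \<alpha> k" "\<zeta> \<in> cl \<beta> k" using \<xi> \<zeta> assms(3,4) by blast+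
    from norm_transfer(2,4,5)[OF X d \<alpha>\<beta> k this \<xi>(2)] show ?thesis using \<xi>(1) by blast
  qed
  have "\<xi> \<in> p \<and> \<zeta> \<in> p \<or> \<xi> \<in> q \<and> \<zeta> \<in> q \<or> bracket \<tau> F \<xi> \<zeta> = bracket \<tau> F \<alpha> \<beta>"
    if "\<xi> \<in> p \<union> q" "\<zeta> \<in> p \<union> q" "\<xi> < \<zeta>" for \<xi> \<zeta>
  proof (rule ccontr)
    assume not: "\<not> ?thesis"
    then have ends: "\<xi> \<in> p - q \<and> \<zeta> \<in> q - p \<or> \<xi> \<in> q - p \<and> \<zeta> \<in> p - q" using that by blast
    moreover have "\<not> (\<xi> \<in> q - p \<and> \<zeta> \<in> p - q)"
      using p[of \<zeta>] q[of \<xi>] dec_less[OF d, of 0 1 \<zeta> \<xi>] two_blocks that(3) by auto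
    ultimately have "\<xi> \<in> D 0 - R" "\<zeta> \<in> D 1 - R" using p[of \<xi>] q[of \<zeta>] by blast+
    then show False using bracket_tails[OF X d] \<alpha>\<beta> not by simp
  qed
  then show ?thesis unfolding bracket_set_def by blast
qed

text \<open>Within one set of level \<open>k\<close> positions increase strictly, so two sets with
  the same positions are enumerated in parallel. This matches \<open>elt\<close>, by which capture
  is defined, with positions.\<close>

lemma sorted_list_of_set_norm:
  assumes z: "z \<subseteq> cl \<gamma> k"
  shows "finite z"
    "map (\<lambda>\<xi>. nrm \<xi> k) (sorted_list_of_set z) = sorted_list_of_set ((\<lambda>\<xi>. nrm \<xi> k) ` z)"
proof -
  obtain Z where "Z \<in> lv k" "cl \<gamma> k \<subseteq> Z" by (rule cl_subset_level)
  then have Z: "Z \<in> lv k" "z \<subseteq> Z" using z by auto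
  show fin: "finite z" by (rule finite_subset[OF Z(2) finite_level[OF Z(1)]])
  have "sorted_wrt (\<lambda>\<xi> \<zeta>. nrm \<xi> k < nrm \<zeta> k) (sorted_list_of_set z)"
  proof (rule sorted_wrt_mono_rel[OF _ strict_sorted_list_of_set])
    fix \<xi> \<zeta>
    assume "\<xi> \<in> set (sorted_list_of_set z)" "\<zeta> \<in> set (sorted_list_of_set z)" "\<xi> < \<zeta>"
    then show "nrm \<xi> k < nrm \<zeta> k" using fin Z(2) norm_less_iff[OF Z(1), of \<xi> \<zeta>] by auto
  qed
  then have "sorted_wrt (<) (map (\<lambda>\<xi>. nrm \<xi> k) (sorted_list_of_set z))"
    unfolding sorted_wrt_map .
  then show "map (\<lambda>\<xi>. nrm \<xi> k) (sorted_list_of_set z) = sorted_list_of_set ((\<lambda>\<xi>. nrm \<xi> k) ` z)"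
    using fin by (intro strict_sorted_equal) auto
qed

text \<open>Matching \<open>x\<close> and \<open>y\<close> by position sends block 0 to block 1 and
  fixes the root. So \<open>x\<close> and \<open>y\<close> form a root-tail-tail system whose root
  is their trace on \<open>R\<close>, and each matched pair of tail points is captured by
  \<open>captured_at_tails\<close>.\<close>

lemma captured_family_if_captured_at:
  assumes "captured_at l \<alpha> \<beta>" "nrm \<alpha> k = nrm \<beta> k" "x \<subseteq> cl \<alpha> k" "y \<subseteq> cl \<beta> k"
    and xy: "(\<lambda>\<xi>. nrm \<xi> k) ` x = (\<lambda>\<xi>. nrm \<xi> k) ` y" and "x \<noteq> y"
  shows "captured_family \<tau> F 2 {x, y} l"
proof -
  obtain j X D R where l: "l = Suc j" and X: "X \<in> lv (Suc j)" and d: "dec (Suc j) X D R"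
    and \<alpha>\<beta>: "\<alpha> \<in> D 0 - R" "\<beta> \<in> D 1 - R" "nrm \<alpha> j = nrm \<beta> j"
    using captured_at_decomposition[OF assms(1)] by blast
  have k: "k \<le> j" using captured_at_level_gt[OF assms(1,2)] l by simp
  note sorted = sorted_list_of_set_norm[of _ _ k]
  have fin: "finite x" "finite y" using sorted(1) assms(3,4) by blast+
  define s t where "s = sorted_list_of_set x" and "t = sorted_list_of_set y"
  have set: "set s = x" "set t = y" using fin by (auto simp: s_def t_def)
  have "map (\<lambda>\<xi>. nrm \<xi> k) s = map (\<lambda>\<xi>. nrm \<xi> k) t"
    using sorted(2)[OF assms(3)] sorted(2)[OF assms(4)] xy by (simp add: s_def t_def)
  then have len: "length t = length s" and nth: "\<And>a. a < length s \<Longrightarrow> nrm (s ! a) k = nrm (t ! a) k"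
    by (metis length_map, metis length_map nth_map)
  have card: "card x = length s" "card y = length s"
    using fin len by (simp_all add: s_def t_def)
  have mono: "s ! a < s ! b" if "a < b" "b < length s" for a b
    using strict_sorted_list_of_set[of x] that sorted_wrt_nth_less by (fastforce simp: s_def)
  have tr: "s ! a \<in> D 0" "t ! a \<in> D 1" "nrm (s ! a) j = nrm (t ! a) j" "s ! a \<in> R \<longleftrightarrow> t ! a \<in> R"
      "s ! a \<in> R \<Longrightarrow> t ! a = s ! a" if a: "a < length s" for a
  proof -
    have "s ! a \<in> x" "t ! a \<in> y" using set len a nth_mem by metis+
    then have cl: "s ! a \<in> cl \<alpha> k" "t ! a \<in> cl \<beta> k" using assms(3,4) by blast+
    note * = norm_transfer[OF X d \<alpha>\<beta> k cl nth[OF a]]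
    show "s ! a \<in> D 0" "t ! a \<in> D 1" "nrm (s ! a) j = nrm (t ! a) j" "s ! a \<in> R \<longleftrightarrow> t ! a \<in> R"
      by (rule *)+
    show "s ! a \<in> R \<Longrightarrow> t ! a = s ! a" by (rule *)
  qed
  \<comment> \<open>The root precedes the tail, so the indices of root elements form an initial
    interval. Its length \<open>c\<close> is the index at which the definition of capture switches
    from root to tail.\<close>
  define A where "A = {a. a < length s \<and> s ! a \<in> R}"
  have "b \<in> A" if a: "a \<in> A" "b < a" for a b
  proof (rule ccontr)
    assume "b \<notin> A"
    moreover have b: "b < length s" using a by (simp add: A_def)
    ultimately have "s ! b \<notin> R" by (simp add: A_def)
    then have "s ! a < s ! b"
      using dec_root_less[OF d two_blocks(1)] a(1) tr(1)[OF b] by (auto simp: A_def)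
    moreover have "s ! b < s ! a" using mono[OF a(2)] a(1) by (simp add: A_def)
    ultimately show False by simp
  qed
  moreover have "finite A" by (simp add: A_def)
  ultimately have A: "A = {..<card A}" by (intro downward_closed_eq_lessThan)
  define c where "c = card A"
  have c: "c \<le> length s" "\<And>a. a < length s \<Longrightarrow> s ! a \<in> R \<longleftrightarrow> a < c"
  proof -
    have "c \<le> card {..<length s}" unfolding c_def by (rule card_mono) (auto simp: A_def)
    then show "c \<le> length s" by simp
    show "s ! a \<in> R \<longleftrightarrow> a < c" if "a < length s" for a
    proof -
      have "s ! a \<in> R \<longleftrightarrow> a \<in> A" using that by (simp add: A_def)
      also have "\<dots> \<longleftrightarrow> a < c" using A unfolding c_def by blast
      finally show ?thesis .
    qed
  qed
  define Q where "Q = x \<inter> y"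
  have Q: "Q = (!) s ` {..<c}"
  proof (intro equalityI subsetI)
    fix \<xi> assume "\<xi> \<in> Q"
    then have \<xi>: "\<xi> \<in> set s" "\<xi> \<in> set t" using set unfolding Q_def by auto
    obtain a where a: "a < length s" "\<xi> = s ! a" using \<xi>(1) by (auto simp: in_set_conv_nth)
    obtain b where b: "b < length s" "\<xi> = t ! b" using \<xi>(2) len by (auto simp: in_set_conv_nth)
    have "\<xi> \<in> R" using dec_Int[OF d, of 0 1] tr(1)[OF a(1)] tr(2)[OF b(1)] a b two_blocks by auto
    then show "\<xi> \<in> (!) s ` {..<c}" using a c(2) by blast
  next
    fix \<xi> assume "\<xi> \<in> (!) s ` {..<c}"
    then obtain a where a: "a < c" "\<xi> = s ! a" by blast
    then have "\<xi> = t ! a" "a < length s" using tr(5)[of a] c by auto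
    then show "\<xi> \<in> Q" unfolding Q_def using a(2) set len nth_mem by (metis IntI)
  qed
  have "inj_on ((!) s) {..<c}"
    using c(1) by (auto simp: inj_on_def s_def nth_eq_iff_index_eq)
  then have cQ: "card Q = c" by (simp add: Q card_image)
  have sub: "x \<subseteq> D 0" "y \<subseteq> D 1"
    using tr(1,2) set len by (auto simp: in_set_conv_nth)
  have QR: "Q = x \<inter> R" "Q = y \<inter> R"
  proof -
    have "\<xi> \<in> y" if \<xi>: "\<xi> \<in> x" "\<xi> \<in> R" for \<xi>
    proof -
      obtain a where "a < length s" "\<xi> = s ! a" using \<xi>(1) set(1) by (auto simp: in_set_conv_nth)
      then show ?thesis using tr(5)[of a] \<xi>(2) set(2) len nth_mem by metis
    qed
    moreover have "\<xi> \<in> x" if \<xi>: "\<xi> \<in> y" "\<xi> \<in> R" for \<xi>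
    proof -
      obtain a where "a < length s" "\<xi> = t ! a" using \<xi>(1) set(2) len by (auto simp: in_set_conv_nth)
      then show ?thesis using tr(4,5)[of a] \<xi>(2) set(1) nth_mem by metis
    qed
    moreover have "x \<inter> y \<subseteq> R" using sub dec_Int[OF d, of 0 1] two_blocks by auto
    ultimately show "Q = x \<inter> R" "Q = y \<inter> R" unfolding Q_def by blast+
  qed
  let ?E = "\<lambda>i::nat. if i = 0 then x else y"
  have rtt: "root_tail_tail 2 ?E Q"
  proof -
    have QR': "Q \<subseteq> R" "x - Q \<subseteq> D 0 - R" "y - Q \<subseteq> D 1 - R" using QR sub by blast+
    have "set_less R (D 0 - R)" "set_less R (D 1 - R)" "set_less (D 0 - R) (D 1 - R)"
      using dec_root_less[OF d, of 0] dec_root_less[OF d, of 1] dec_less[OF d, of 0 1] two_blocks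
      by (auto simp: set_less_def)
    then have "set_less Q (x - Q)" "set_less Q (y - Q)" "set_less (x - Q) (y - Q)"
      using QR' unfolding set_less_def by blast+
    then show ?thesis
      by (simp add: root_tail_tail_def less_2_cases_iff Q_def)
  qed
  have elts: "captured_at l (s ! a) (t ! a)" if "c \<le> a" "a < length s" for a
    using captured_at_tails[OF X d, of "s ! a" "t ! a"] tr[OF that(2)] c(2)[OF that(2)] that l by auto
  have Xi_root: "Xi \<tau> F \<xi> l = -1" if "\<xi> \<in> R" for \<xi>
    using dec_mem_root_iff[OF d _ X] dec_root[OF d two_blocks(1)] dec_Union[OF d] two_blocks(1) that l by (auto simp: Xi_Suc)
  have "captured_seq \<tau> F 2 ?E l"
    unfolding captured_seq_def
  proof (intro exI[of _ "length s"] exI[of _ Q] conjI)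
    show "\<forall>i<2. \<forall>a<card Q. Xi \<tau> F (elt (?E i) a) l = -1"
      using c tr(4) Xi_root cQ by (auto simp: s_def[symmetric] t_def[symmetric])
    show "\<forall>i<2. \<forall>a\<in>{card Q..<length s}. Xi \<tau> F (elt (?E i) a) l = int i"
      using elts cQ by (auto simp: s_def[symmetric] t_def[symmetric] captured_at_def less_2_cases_iff)
    show "\<forall>j<2. \<forall>i<j. \<forall>a\<in>{card Q..<length s}. \<rho> (elt (?E i) a) (elt (?E j) a) = l \<and>
        Delta \<tau> F (elt (?E i) a) (elt (?E j) a) = l"
      using elts cQ by (auto simp: s_def[symmetric] t_def[symmetric] captured_at_def less_2_cases_iff)
  qed (use fin card rtt in auto)
  then show ?thesis
    unfolding captured_family_def using assms(6)
    by (intro exI[of _ ?E]) (auto simp: inj_on_def less_2_cases_iff numeral_2_eq_2 lessThan_Suc)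
qed

lemma captured_pair_iff:
  assumes "\<alpha> < \<beta>"
  shows "captured_pair \<tau> F \<alpha> \<beta> \<longleftrightarrow> (\<exists>l. captured_at l \<alpha> \<beta>)"
proof
  show "captured_pair \<tau> F \<alpha> \<beta> \<Longrightarrow> \<exists>l. captured_at l \<alpha> \<beta>"
    using captured_at_if_captured_family assms by (auto simp: captured_pair_def)
next
  assume "\<exists>l. captured_at l \<alpha> \<beta>"
  then obtain l where l: "captured_at l \<alpha> \<beta>" by blast
  then obtain k where k: "nrm \<alpha> k = nrm \<beta> k" using captured_at_decomposition by metis
  have "\<gamma> \<in> cl \<gamma> k" for \<gamma>
    using closure_eq by (metis IntI atMost_iff level_covers order_refl)
  then show "captured_pair \<tau> F \<alpha> \<beta>"
    using captured_family_if_captured_at[OF l k, of "{\<alpha>}" "{\<beta>}"] k assms by (auto simp: captured_pair_def)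
qed

end

section \<open>Common brackets\<close>

lemma uncountable_fibre:
  assumes "uncountable S" "countable (g ` S)"
  obtains v where "uncountable {x \<in> S. g x = v}"
proof (rule ccontr)
  assume "\<not> thesis"
  then have "countable {x \<in> S. g x = v}" for v using that by blast
  then have "countable (\<Union>v\<in>g ` S. {x \<in> S. g x = v})" using assms(2) by blast
  moreover have "(\<Union>v\<in>g ` S. {x \<in> S. g x = v}) = S" by auto
  ultimately show False using assms(1) by simp
qed

lemma omega1_inj_into_uncountable:
  assumes "uncountable I"
  obtains e :: "omega1 \<Rightarrow> 'i" where "inj e" "range e \<subseteq> I"
proof -
  have "natLeq <o |I|"
    using assms not_ordLeq_iff_ordLess[OF natLeq_Well_order card_of_Well_order, of I]
    by (simp add: countable_card_le_natLeq)
  then have "cardSuc natLeq \<le>o |I|"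
    by (simp add: cardSuc_ordLess_ordLeq[OF natLeq_Card_order card_of_Card_order])
  then have "|UNIV :: omega1 set| \<le>o |I|"
    using card_omega1 ordIso_ordLeq_trans by blast
  then show thesis using that by (auto simp flip: card_of_ordLeq)
qed

lemma countable_atMost_omega1: "countable {..\<alpha>::omega1}"
proof -
  have "{..\<alpha>} = insert \<alpha> {..<\<alpha>}" by auto
  then show ?thesis using countable_below_omega1 by simp
qed

lemma VF_mono: "A \<in> VF \<tau> F \<Longrightarrow> A \<subseteq> B \<Longrightarrow> B \<in> VF \<tau> F"
  by (auto simp: VF_def)

lemma bracket_set_mono: "S \<subseteq> T \<Longrightarrow> bracket_set \<tau> F S \<subseteq> bracket_set \<tau> F T"
  by (auto simp: bracket_set_def)

lemma finite_bracket_set: "finite S \<Longrightarrow> finite (bracket_set \<tau> F S)"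
proof -
  assume "finite S"
  moreover have "bracket_set \<tau> F S \<subseteq> (\<lambda>(\<alpha>, \<beta>). bracket \<tau> F \<alpha> \<beta>) ` (S \<times> S)"
    by (auto simp: bracket_set_def)
  ultimately show ?thesis by (meson finite_SigmaI finite_imageI finite_subset)
qed

context scheme
begin

text \<open>
  The code \<open>f k i\<close> of an index may depend on the level \<open>k\<close>, which is chosen only after the index set
  has been thinned out; it is used for the positions at level \<open>k\<close> of finite sets attached to \<open>i\<close>.
\<close>

lemma common_capture:
  fixes I :: "'i set" and y :: "'i \<Rightarrow> omega1 set" and f :: "nat \<Rightarrow> 'i \<Rightarrow> 'c"
  assumes I: "uncountable I" and y: "\<And>i. i \<in> I \<Longrightarrow> finite (y i)"
    and f: "countable C" "\<And>k i. i \<in> I \<Longrightarrow> f k i \<in> C"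
    and A: "- A \<notin> VF \<tau> F"
  obtains i j k l \<alpha> \<beta> where "i \<in> I" "j \<in> I" "i \<noteq> j" "N \<le> k" "captured_at l \<alpha> \<beta>" "nrm \<alpha> k = nrm \<beta> k"
    "y i \<subseteq> cl \<alpha> k" "y j \<subseteq> cl \<beta> k" "f k i = f k j" "bracket \<tau> F \<alpha> \<beta> \<in> A"
proof -
  obtain e :: "omega1 \<Rightarrow> 'i" where e: "inj e" "range e \<subseteq> I" using omega1_inj_into_uncountable[OF I] .
  have eI: "e \<xi> \<in> I" for \<xi> using e by auto
  \<comment> \<open>including \<open>\<xi>\<close> makes \<open>top\<close> countable-to-one\<close>
  define top where "top \<xi> = Max (insert \<xi> (y (e \<xi>)))" for \<xi>
  have top: "\<xi> \<le> top \<xi>" "\<zeta> \<in> y (e \<xi>) \<Longrightarrow> \<zeta> \<le> top \<xi>" for \<xi> \<zeta>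
    using y[OF eI] by (auto simp: top_def)
  have "uncountable (range top)"
  proof
    assume "countable (range top)"
    then obtain \<gamma> where "uncountable {\<xi> \<in> UNIV. top \<xi> = \<gamma>}"
      using uncountable_fibre[OF uncountable_omega1] by blast
    moreover have "{\<xi> \<in> UNIV. top \<xi> = \<gamma>} \<subseteq> {..\<gamma>}" using top(1) by auto
    ultimately show False using countable_atMost_omega1 countable_subset by blast
  qed
  \<comment> \<open>One index is chosen for each value of \<open>top\<close>. A finite set is
    thereby represented by the single ordinal bounding it, and distinct ordinals represent distinct
    indices.\<close>
  define sel where "sel \<gamma> = e (inv top \<gamma>)" for \<gamma>
  have top_sel: "top (inv top \<gamma>) = \<gamma>" if "\<gamma> \<in> range top" for \<gamma>
    using that by (rule f_inv_into_f)
  have "\<exists>k\<ge>N. y (sel \<gamma>) \<subseteq> cl \<gamma> k" if \<gamma>: "\<gamma> \<in> range top" for \<gamma>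
  proof -
    have "finite (insert \<gamma> (y (sel \<gamma>)))" using y[OF eI] by (simp add: sel_def)
    then obtain k X where X: "N \<le> k" "X \<in> lv k" "insert \<gamma> (y (sel \<gamma>)) \<subseteq> X"
      by (rule level_cofinal)
    have "y (sel \<gamma>) \<subseteq> X \<inter> {..\<gamma>}" using X(3) top(2)[of _ "inv top \<gamma>"] top_sel[OF \<gamma>] by (auto simp: sel_def)
    then show ?thesis using X closure_eq[of X k \<gamma>] by auto
  qed
  then obtain K where K: "\<And>\<gamma>. \<gamma> \<in> range top \<Longrightarrow> N \<le> K \<gamma> \<and> y (sel \<gamma>) \<subseteq> cl \<gamma> (K \<gamma>)" by metis
  define code where "code \<gamma> = (K \<gamma>, nrm \<gamma> (K \<gamma>), f (K \<gamma>) (sel \<gamma>))" for \<gamma>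
  have "code ` range top \<subseteq> UNIV \<times> UNIV \<times> C" using f(2)[OF eI] by (auto simp: code_def sel_def)
  then have "countable (code ` range top)"
    by (rule countable_subset) (intro countable_SIGMA f(1) countableI_type)
  then obtain v where v: "uncountable {\<gamma> \<in> range top. code \<gamma> = v}" (is "uncountable ?S")
    using uncountable_fibre[OF \<open>uncountable (range top)\<close>] by blast
  \<comment> \<open>If all brackets of this uncountable set avoided \<open>A\<close>, the set would
    witness that \<open>- A\<close> is in V(F).\<close>
  then have "\<not> bracket_set \<tau> F ?S \<subseteq> - A" using A unfolding VF_def by blast
  then obtain \<alpha> \<beta> where \<alpha>\<beta>: "\<alpha> \<in> ?S" "\<beta> \<in> ?S" "\<alpha> < \<beta>" "captured_pair \<tau> F \<alpha> \<beta>" "bracket \<tau> F \<alpha> \<beta> \<in> A"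
    unfolding bracket_set_def by blast
  then obtain l where l: "captured_at l \<alpha> \<beta>" using captured_pair_iff by blast
  have code: "K \<alpha> = K \<beta>" "nrm \<alpha> (K \<alpha>) = nrm \<beta> (K \<alpha>)" "f (K \<alpha>) (sel \<alpha>) = f (K \<alpha>) (sel \<beta>)"
    using \<alpha>\<beta>(1,2) by (auto simp: code_def)
  have "sel \<alpha> \<noteq> sel \<beta>"
  proof
    assume "sel \<alpha> = sel \<beta>"
    then have "inv top \<alpha> = inv top \<beta>" using e(1) by (simp add: sel_def inj_eq)
    moreover have "top (inv top \<alpha>) = \<alpha>" "top (inv top \<beta>) = \<beta>" using \<alpha>\<beta>(1,2) top_sel by blast+
    ultimately have "\<alpha> = \<beta>" by metis
    then show False using \<alpha>\<beta>(3) by simp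
  qed
  moreover have "sel \<alpha> \<in> I" "sel \<beta> \<in> I" using eI by (simp_all add: sel_def)
  moreover have "N \<le> K \<alpha>" "y (sel \<alpha>) \<subseteq> cl \<alpha> (K \<alpha>)" "y (sel \<beta>) \<subseteq> cl \<beta> (K \<alpha>)"
    using K[of \<alpha>] K[of \<beta>] \<alpha>\<beta>(1,2) code(1) by auto
  ultimately show thesis using that l code(2,3) \<alpha>\<beta>(5) by blast
qed

lemma empty_not_VF:
  assumes "capturing \<tau> F 2"
  shows "{} \<notin> VF \<tau> F"
proof
  assume "{} \<in> VF \<tau> F"
  then obtain S where S: "uncountable S" "bracket_set \<tau> F S = {}" by (auto simp: VF_def)
  have "uncountable ((\<lambda>\<alpha>. {\<alpha>}) ` S)"
    using S(1) countable_image_inj_on[of "\<lambda>\<alpha>. {\<alpha>}" S] by (auto simp: inj_on_def)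
  then have "infinite {l. \<exists>\<D>\<subseteq>(\<lambda>\<alpha>. {\<alpha>}) ` S. captured_family \<tau> F 2 \<D> l}"
    using assms[unfolded capturing_def, rule_format, of "(\<lambda>\<alpha>. {\<alpha>}) ` S"] by simp
  then obtain l \<D> where \<D>: "\<D> \<subseteq> (\<lambda>\<alpha>. {\<alpha>}) ` S" "captured_family \<tau> F 2 \<D> l"
    using not_finite_existsD by blast
  obtain D where D: "inj_on D {..<2::nat}" "\<D> = D ` {..<2}" using \<D>(2) by (auto simp: captured_family_def)
  have "\<D> = {D 0, D 1}" unfolding D(2) by (auto simp: numeral_2_eq_2 lessThan_Suc)
  moreover have "D 0 \<noteq> D 1" using inj_onD[OF D(1), of 0 1] by auto
  ultimately obtain \<alpha> \<beta> where \<alpha>\<beta>: "\<alpha> \<in> S" "\<beta> \<in> S" "\<alpha> \<noteq> \<beta>" "\<D> = {{\<alpha>}, {\<beta>}}" using \<D>(1) by auto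
  have "captured_pair \<tau> F \<alpha> \<beta>" "captured_pair \<tau> F \<beta> \<alpha>"
    using \<D>(2) unfolding captured_pair_def \<alpha>\<beta>(4) by (auto simp: insert_commute)
  then have "bracket_set \<tau> F S \<noteq> {}"
    using \<alpha>\<beta>(1-3) unfolding bracket_set_def by (cases "\<alpha> < \<beta>") (blast, force)
  then show False using S(2) by simp
qed

text \<open>One ordinal from each of the three sets is attached to every index. Coding all three
  positions makes \<open>captured_at_transfer\<close> apply to each of the three pairs, and each
  then has the bracket of \<open>\<alpha>\<close>, \<open>\<beta>\<close>.\<close>

lemma common_bracket:
  assumes "{} \<notin> VF \<tau> F" "uncountable S" "uncountable T" "uncountable U"
  obtains \<gamma> where "\<gamma> \<in> bracket_set \<tau> F S" "\<gamma> \<in> bracket_set \<tau> F T" "\<gamma> \<in> bracket_set \<tau> F U"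
proof -
  obtain s :: "omega1 \<Rightarrow> omega1" where s: "inj s" "range s \<subseteq> S"
    using omega1_inj_into_uncountable[OF assms(2)] .
  obtain t :: "omega1 \<Rightarrow> omega1" where t: "inj t" "range t \<subseteq> T"
    using omega1_inj_into_uncountable[OF assms(3)] .
  obtain u :: "omega1 \<Rightarrow> omega1" where u: "inj u" "range u \<subseteq> U"
    using omega1_inj_into_uncountable[OF assms(4)] .
  obtain i j k l \<alpha> \<beta> where ij: "i \<noteq> j" and captured_at: "captured_at l \<alpha> \<beta>" "nrm \<alpha> k = nrm \<beta> k"
    and cl: "{s i, t i, u i} \<subseteq> cl \<alpha> k" "{s j, t j, u j} \<subseteq> cl \<beta> k"
    and code: "(nrm (s i) k, nrm (t i) k, nrm (u i) k) = (nrm (s j) k, nrm (t j) k, nrm (u j) k)"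
  proof (rule common_capture[of UNIV "\<lambda>i. {s i, t i, u i}" UNIV
          "\<lambda>k i. (nrm (s i) k, nrm (t i) k, nrm (u i) k)" UNIV 0])
    show "- UNIV \<notin> VF \<tau> F" using assms(1) by simp
    fix i j k l \<alpha> \<beta>
    assume "i \<noteq> j" "captured_at l \<alpha> \<beta>" "nrm \<alpha> k = nrm \<beta> k"
      "{s i, t i, u i} \<subseteq> cl \<alpha> k" "{s j, t j, u j} \<subseteq> cl \<beta> k"
      "(nrm (s i) k, nrm (t i) k, nrm (u i) k) = (nrm (s j) k, nrm (t j) k, nrm (u j) k)"
    then show thesis by (rule that)
  qed (simp_all add: uncountable_omega1)
  have *: "bracket \<tau> F \<alpha> \<beta> \<in> bracket_set \<tau> F V"
    if "w i \<in> cl \<alpha> k" "w j \<in> cl \<beta> k" "nrm (w i) k = nrm (w j) k" "inj w" "range w \<subseteq> V"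
    for w :: "omega1 \<Rightarrow> omega1" and V
  proof -
    have "w i \<noteq> w j" using that(4) ij by (simp add: inj_eq)
    note * = captured_at_transfer[OF captured_at that(1-3) this]
    have "w i < w j" using *(1) by (simp add: captured_at_def)
    moreover have "captured_pair \<tau> F (w i) (w j)" using captured_pair_iff[OF calculation] *(1) by blast
    ultimately show ?thesis using that(5) *(2)[symmetric] unfolding bracket_set_def by blast
  qed
  show thesis
  proof (rule that)
    show "bracket \<tau> F \<alpha> \<beta> \<in> bracket_set \<tau> F S" using *[of s S] cl code s by simp
    show "bracket \<tau> F \<alpha> \<beta> \<in> bracket_set \<tau> F T" using *[of t T] cl code t by simp
    show "bracket \<tau> F \<alpha> \<beta> \<in> bracket_set \<tau> F U" using *[of u U] cl code u by simp
  qed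
qed

text \<open>Three sets rather than two: closure under intersection will follow from the dichotomy by
  applying this to two sets and the complement of their intersection.\<close>

lemma VF_Int:
  assumes "{} \<notin> VF \<tau> F" "A \<in> VF \<tau> F" "B \<in> VF \<tau> F" "C \<in> VF \<tau> F"
  shows "A \<inter> B \<inter> C \<noteq> {}"
proof -
  obtain S where S: "uncountable S" "bracket_set \<tau> F S \<subseteq> A" using assms(2) unfolding VF_def by blast
  obtain T where T: "uncountable T" "bracket_set \<tau> F T \<subseteq> B" using assms(3) unfolding VF_def by blast
  obtain U where U: "uncountable U" "bracket_set \<tau> F U \<subseteq> C" using assms(4) unfolding VF_def by blast
  obtain \<gamma> where "\<gamma> \<in> bracket_set \<tau> F S" "\<gamma> \<in> bracket_set \<tau> F T" "\<gamma> \<in> bracket_set \<tau> F U"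
    using common_bracket[OF assms(1) S(1) T(1) U(1)] .
  then show ?thesis using S(2) T(2) U(2) by blast
qed

end

section \<open>Forcing\<close>

lemma min_card_in:
  assumes "C \<noteq> {}" "\<And>\<kappa>. \<kappa> \<in> C \<Longrightarrow> Well_order \<kappa>"
  shows "min_card C \<in> C" "\<kappa> \<in> C \<Longrightarrow> min_card C \<le>o \<kappa>"
proof -
  have "\<exists>\<kappa>\<in>C. \<forall>\<mu>\<in>C. \<kappa> \<le>o \<mu>"
    using exists_minim_Well_order[OF assms(1)] assms(2) by blast
  then have "min_card C \<in> C \<and> (\<forall>\<mu>\<in>C. min_card C \<le>o \<mu>)"
    unfolding min_card_def by (intro someI_ex[of "\<lambda>\<kappa>. \<kappa> \<in> C \<and> (\<forall>\<mu>\<in>C. \<kappa> \<le>o \<mu>)"]) blast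
  then show "min_card C \<in> C" "\<kappa> \<in> C \<Longrightarrow> min_card C \<le>o \<kappa>" by blast+
qed

lemma mart_le:
  assumes "unmet P \<D>"
  shows "Well_order (mart P)" "mart P \<le>o |\<D>|"
proof -
  have ne: "{|\<D>| |\<D>. unmet P \<D>} \<noteq> {}" using assms by blast
  have wo: "Well_order \<kappa>" if "\<kappa> \<in> {|\<D>| |\<D>. unmet P \<D>}" for \<kappa>
    using that card_of_Well_order by blast
  show "Well_order (mart P)" unfolding mart_def by (rule wo) (rule min_card_in(1)[OF ne wo])
  show "mart P \<le>o |\<D>|" unfolding mart_def by (rule min_card_in(2)[OF ne wo]) (use assms in blast)+
qed

text \<open>An unmet family of at most \<omega>1 dense sets would make \<open>P\<close> contribute
  to the minimum and so bound \<open>mart_scheme\<close> by \<omega>1.\<close>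

lemma generic_filter_exists:
  fixes P :: "'p rel" and \<D> :: "'p set set"
  assumes "|UNIV :: omega1 set| <o (mart_scheme \<tau> F :: 'p set rel)"
    and P: "forcing_notion P" "ccc P" "forced P (fcapturing P \<tau> F 2)"
    and \<D>: "|\<D>| \<le>o |UNIV :: omega1 set|" "\<And>D. D \<in> \<D> \<Longrightarrow> dense_subset P D"
  obtains G where "forcing_filter P G" "\<And>D. D \<in> \<D> \<Longrightarrow> G \<inter> D \<noteq> {}"
proof (rule ccontr)
  assume "\<not> thesis"
  then have un: "unmet P \<D>" using that \<D>(2) unfolding unmet_def by blast
  let ?C = "{mart P |P :: 'p rel. forcing_notion P \<and> ccc P \<and> forced P (fcapturing P \<tau> F 2) \<and> (\<exists>\<D>. unmet P \<D>)}"
  have in_C: "mart P \<in> ?C" using P un by blast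
  have "(mart_scheme \<tau> F :: 'p set rel) \<le>o mart P"
    unfolding mart_scheme_def
  proof (rule min_card_in(2)[OF _ _ in_C])
    show "?C \<noteq> {}" using in_C by blast
    show "Well_order \<kappa>" if "\<kappa> \<in> ?C" for \<kappa>
      using that mart_le(1) by blast
  qed
  also have "mart P \<le>o |\<D>|" by (rule mart_le(2)[OF un])
  also note \<D>(1)
  finally show False using assms(1) not_ordLess_ordLeq by blast
qed

context
  fixes P :: "'p rel"
  assumes P: "forcing_notion P"
begin

lemma P_refl: "p \<in> Field P \<Longrightarrow> (p, p) \<in> P"
  using P by (auto simp: forcing_notion_def preorder_on_def refl_on_def)

lemma P_trans: "(p, q) \<in> P \<Longrightarrow> (q, s) \<in> P \<Longrightarrow> (p, s) \<in> P"
  using P by (auto simp: forcing_notion_def preorder_on_def dest: transD)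

lemma P_Field: "(p, q) \<in> P \<Longrightarrow> p \<in> Field P" "(p, q) \<in> P \<Longrightarrow> q \<in> Field P"
  by (auto simp: Field_def)

lemma fmem_mono: "fmem P x \<sigma> p \<Longrightarrow> (q, p) \<in> P \<Longrightarrow> fmem P x \<sigma> q"
  unfolding fmem_def using P_trans by blast

lemma fmem_in:
  assumes "(x, p) \<in> \<sigma>" "p \<in> Field P"
  shows "fmem P x \<sigma> p"
  using assms P_refl P_Field unfolding fmem_def by blast

lemma fmemD:
  assumes "fmem P x \<sigma> p" "p \<in> Field P"
  obtains s where "(x, s) \<in> \<sigma>"
  using assms P_refl unfolding fmem_def by blast

text \<open>The negations hidden in the connective leave a density statement: the conclusion is
  found at some extension of \<open>q\<close>, not necessarily at \<open>q\<close> itself. The same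
  happens in \<open>fex_iff\<close>.\<close>

lemma fimp_iff: "fimp P \<phi> \<psi> p \<longleftrightarrow> (\<forall>q. (q, p) \<in> P \<longrightarrow> \<phi> q \<longrightarrow> (\<exists>s. (s, q) \<in> P \<and> \<psi> s))"
  unfolding fimp_def fneg_def fand_def by blast

lemma fex_iff: "fex P \<phi> p \<longleftrightarrow> (\<forall>q. (q, p) \<in> P \<longrightarrow> (\<exists>x s. (s, q) \<in> P \<and> \<phi> x s))"
  unfolding fex_def fneg_def fall_def by blast

text \<open>Used in contrapositive form: a name not forced to be countable has uncountably many
  possible elements, which form an uncountable family in the ground model.\<close>

lemma fcountable_if_countable:
  assumes "p \<in> Field P" and B: "countable {x. \<exists>t. (t, p) \<in> P \<and> fmem P x \<sigma> t}" (is "countable ?B")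
  shows "fcountable P \<sigma> p"
proof -
  \<comment> \<open>the name of a ground model enumeration\<close>
  define f where "f = {((to_nat_on ?B x, x), s) |x s. x \<in> ?B \<and> s \<in> Field P}"
  have f: "fmem P (i, x) f q \<Longrightarrow> x \<in> ?B \<and> i = to_nat_on ?B x" if "q \<in> Field P" for i x q
    using that fmemD[of "(i, x)" f q] unfolding f_def by blast
  have f': "fmem P (to_nat_on ?B x, x) f q" if "x \<in> ?B" "q \<in> Field P" for x q
    using that by (intro fmem_in) (auto simp: f_def)
  have functional: "fimp P (fand (fmem P (i, x) f) (fmem P (i, y) f)) (fground (x = y)) q" for i x y q
    unfolding fimp_iff
  proof (intro allI impI)
    fix q' assume q': "(q', q) \<in> P" "fand (fmem P (i, x) f) (fmem P (i, y) f) q'"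
    have "q' \<in> Field P" using P_Field q' by blast
    then have "x = y"
      using f[of q' i x] f[of q' i y] q'(2) inj_on_to_nat_on[OF B] unfolding fand_def
      by (auto dest: inj_onD)
    then show "\<exists>s. (s, q') \<in> P \<and> fground (x = y) s"
      using P_refl[OF \<open>q' \<in> Field P\<close>] by (auto simp: fground_def)
  qed
  have cov: "fimp P (fmem P x \<sigma>) (fex P (\<lambda>i. fmem P (i, x) f)) q" if "(q, p) \<in> P" for x q
    unfolding fimp_iff
  proof (intro allI impI)
    fix q' assume q': "(q', q) \<in> P" "fmem P x \<sigma> q'"
    then have x: "x \<in> ?B" using P_trans that by blast
    have "fex P (\<lambda>i. fmem P (i, x) f) q'"
      unfolding fex_iff using f'[OF x] P_Field P_refl by blast
    then show "\<exists>s. (s, q') \<in> P \<and> fex P (\<lambda>i. fmem P (i, x) f) s"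
      using P_refl P_Field q' by blast
  qed
  show ?thesis
    unfolding fcountable_def
  proof (subst fex_iff, intro allI impI exI conjI)
    fix q assume q: "(q, p) \<in> P"
    show "(q, q) \<in> P" using P_refl P_Field q by blast
    show "fand
         (fall (\<lambda>i. fall (\<lambda>x. fall (\<lambda>y.
            fimp P (fand (fmem P (i, x) f) (fmem P (i, y) f)) (fground (x = y))))))
         (fall (\<lambda>x. fimp P (fmem P x \<sigma>) (fex P (\<lambda>i. fmem P (i, x) f)))) q"
      unfolding fand_def[of "fall _"] fall_def by (intro conjI allI functional cov[OF q])
  qed
qed

text \<open>Reduces preservation to a ground model statement. Each possible element \<open>x\<close>
  of the name gets a condition \<open>t x\<close> forcing it in. A common extension of
  \<open>t x\<close> and \<open>t y\<close> forces both sets into the name, and being captured is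
  absolute.\<close>

lemma forced_fcapturingI:
  assumes key: "\<And>B t N. \<lbrakk>uncountable B; \<forall>x\<in>B. finite x \<and> t x \<in> Field P\<rbrakk> \<Longrightarrow>
    \<exists>x\<in>B. \<exists>y\<in>B. \<exists>l\<ge>N. \<exists>s. (s, t x) \<in> P \<and> (s, t y) \<in> P \<and> captured_family \<tau> F 2 {x, y} l"
  shows "forced P (fcapturing P \<tau> F 2)"
proof -
  have main: "\<exists>l x y s. (s, p) \<in> P \<and> N \<le> l \<and> captured_family \<tau> F 2 {x, y} l \<and> fmem P x \<sigma> s \<and> fmem P y \<sigma> s"
    if p: "p \<in> Field P" and fin: "\<And>x. fimp P (fmem P x \<sigma>) (fground (finite x)) p"
      and unc: "\<not> fcountable P \<sigma> p" for \<sigma> p N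
  proof -
    \<comment> \<open>The sets that some extension of \<open>p\<close> forces into
      \<open>\<sigma>\<close>.\<close>
    define B where "B = {x. \<exists>t. (t, p) \<in> P \<and> fmem P x \<sigma> t}"
    have "uncountable B" using fcountable_if_countable[OF p] unc unfolding B_def by blast
    have "\<forall>x\<in>B. \<exists>t. (t, p) \<in> P \<and> fmem P x \<sigma> t" unfolding B_def by blast
    then obtain t where t: "\<And>x. x \<in> B \<Longrightarrow> (t x, p) \<in> P \<and> fmem P x \<sigma> (t x)" by metis
    have "\<forall>x\<in>B. finite x \<and> t x \<in> Field P"
      using fin t P_Field(1) unfolding fimp_iff fground_def by blast
    from key[OF \<open>uncountable B\<close> this, of N] obtain x y l s where
      xy: "x \<in> B" "y \<in> B" and l: "N \<le> l" "captured_family \<tau> F 2 {x, y} l"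
      and s: "(s, t x) \<in> P" "(s, t y) \<in> P"
      by (elim bexE exE conjE)
    have "fmem P x \<sigma> s" "fmem P y \<sigma> s"
      using fmem_mono[OF conjunct2[OF t] s(1)] fmem_mono[OF conjunct2[OF t] s(2)] xy by simp_all
    moreover have "(s, p) \<in> P" by (rule P_trans[OF s(1) conjunct1[OF t[OF xy(1)]]])
    ultimately show ?thesis using l by blast
  qed
  let ?fin = "\<lambda>\<sigma>. fall (\<lambda>x. fimp P (fmem P x \<sigma>) (fground (finite x)))"
  let ?C = "\<lambda>(\<sigma> :: (omega1 set \<times> 'p) set) l \<D>. fand
               (fall (\<lambda>x. fimp P (fground (x \<in> \<D>)) (fmem P x \<sigma>)))
               (fground (captured_family \<tau> F 2 \<D> l))"
  let ?L = "\<lambda>(\<sigma> :: (omega1 set \<times> 'p) set) (k :: nat) l. fand (fground (k \<le> l)) (fex P (?C \<sigma> l))"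
  let ?inf = "\<lambda>\<sigma>. fall (\<lambda>k. fex P (?L \<sigma> k))"
  have "fex P (?L \<sigma> N) q" if q: "q \<in> Field P" "?fin \<sigma> q" "fneg P (fcountable P \<sigma>) q" for \<sigma> q N
    unfolding fex_iff[of "?L \<sigma> N"]
  proof (intro allI impI)
    fix s assume s: "(s, q) \<in> P"
    have "fimp P (fmem P x \<sigma>) (fground (finite x)) s" for x
      using q(2) P_trans[OF _ s] unfolding fall_def fimp_iff by blast
    moreover have "\<not> fcountable P \<sigma> s" using q(3) s unfolding fneg_def by blast
    ultimately obtain l x y t where t: "(t, s) \<in> P" "N \<le> l" "captured_family \<tau> F 2 {x, y} l"
      "fmem P x \<sigma> t" "fmem P y \<sigma> t" using main[of s \<sigma> N] P_Field(1)[OF s] by blast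
    have "fex P (?C \<sigma> l) t"
      unfolding fex_iff[of "?C \<sigma> l"]
    proof (intro allI impI exI conjI)
      fix t' assume t': "(t', t) \<in> P"
      show "(t', t') \<in> P" using P_refl P_Field(1)[OF t'] by blast
      have "fimp P (fground (z \<in> {x, y})) (fmem P z \<sigma>) t'" for z
        unfolding fimp_iff fground_def
      proof (intro allI impI)
        fix u assume u: "(u, t') \<in> P" "z \<in> {x, y}"
        have "(u, t) \<in> P" by (rule P_trans[OF u(1) t'])
        moreover have "fmem P z \<sigma> t" using t u(2) by blast
        ultimately have "fmem P z \<sigma> u" by (rule fmem_mono[rotated])
        then show "\<exists>s. (s, u) \<in> P \<and> fmem P z \<sigma> s" using P_refl P_Field(1)[OF u(1)] by blast
      qed
      then show "?C \<sigma> l {x, y} t'"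
        using t(3) unfolding fand_def[of "fall _"] fall_def fground_def by blast
    qed
    then have "?L \<sigma> N l t" using t(2) unfolding fand_def[of "fground _"] fground_def[of "N \<le> l"] by blast
    then show "\<exists>l t. (t, s) \<in> P \<and> ?L \<sigma> N l t" using t(1) by blast
  qed
  then have inf: "?inf \<sigma> q" if "q \<in> Field P" "?fin \<sigma> q" "fneg P (fcountable P \<sigma>) q" for \<sigma> q
    using that unfolding fall_def[of "\<lambda>k. fex P (?L \<sigma> k)"] by blast
  show ?thesis
    unfolding forced_def fcapturing_def
  proof (intro ballI)
    fix p assume "p \<in> Field P"
    show "fall (\<lambda>\<sigma>. fimp P (fand (?fin \<sigma>) (fneg P (fcountable P \<sigma>))) (?inf \<sigma>)) p"
      unfolding fall_def[of "\<lambda>\<sigma>. fimp P (fand (?fin \<sigma>) (fneg P (fcountable P \<sigma>))) (?inf \<sigma>)"]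
    proof (rule allI)
      fix \<sigma>
      show "fimp P (fand (?fin \<sigma>) (fneg P (fcountable P \<sigma>))) (?inf \<sigma>) p"
        unfolding fimp_iff[of "fand (?fin \<sigma>) (fneg P (fcountable P \<sigma>))"]
      proof (intro allI impI)
        fix q assume q: "(q, p) \<in> P" "fand (?fin \<sigma>) (fneg P (fcountable P \<sigma>)) q"
        have "q \<in> Field P" using P_Field q by blast
        then show "\<exists>s. (s, q) \<in> P \<and> ?inf \<sigma> s"
          using inf[of q \<sigma>] q(2) P_refl[of q] unfolding fand_def[of "?fin \<sigma>"] by blast
      qed
    qed
  qed
qed

end

section \<open>Homogeneous sets\<close>

lemma countable_finite_subsets: "countable {A :: 'a::countable set. finite A}"
  using countable_Collect_finite by simp

lemma card_of_Times_ordLeq_self: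
  assumes "infinite A" "|B| \<le>o |A|"
  shows "|A \<times> B| \<le>o |A|"
  by (rule card_of_Times_ordLeq_infinite_Field[OF _ _ assms(2) card_of_Card_order])
    (simp_all add: assms(1) Field_card_of card_of_mono1)

text \<open>Bounds the number of conditions, which have to be coded by elements of the type
  \<open>'p\<close>. The finite subsets are split by their cardinality.\<close>

lemma card_of_Fpow_ordLeq_infinite:
  assumes "infinite A"
  shows "|Fpow A| \<le>o |A|"
proof -
  define X where "X k = {B. B \<subseteq> A \<and> finite B \<and> card B = k}" for k
  have "|X k| \<le>o |A|" for k
  proof (induction k)
    case 0
    have "X 0 = {{}}" by (auto simp: X_def)
    moreover have "A \<noteq> {}" using assms by auto
    ultimately show ?case using card_of_singl_ordLeq by simp
  next
    case (Suc k)
    have "X (Suc k) \<subseteq> case_prod insert ` (A \<times> X k)"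
    proof
      fix B assume B: "B \<in> X (Suc k)"
      then obtain b where b: "b \<in> B" by (fastforce simp: X_def)
      then have "(b, B - {b}) \<in> A \<times> X k" using B by (auto simp: X_def)
      moreover have "B = case_prod insert (b, B - {b})" using b by auto
      ultimately show "B \<in> case_prod insert ` (A \<times> X k)" by blast
    qed
    then have "|X (Suc k)| \<le>o |A \<times> X k|"
      using card_of_mono1 card_of_image ordLeq_transitive by blast
    also have "|A \<times> X k| \<le>o |A|"
      by (rule card_of_Times_ordLeq_self[OF assms Suc])
    finally show ?case .
  qed
  moreover have "|UNIV :: nat set| \<le>o |A|" using assms infinite_iff_card_of_nat by blast
  ultimately have "|\<Union>k. X k| \<le>o |A|"
    using card_of_UNION_ordLeq_infinite[OF assms] by blast
  moreover have "Fpow A = (\<Union>k. X k)" by (auto simp: Fpow_def X_def)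
  ultimately show ?thesis by simp
qed

context scheme
begin

text \<open>\<open>\<G>\<close> is the family of permitted colour sets for brackets coloured by
  \<open>c\<close>. The last assumption treats finitely many members of \<open>\<G>\<close> at once
  because the one new bracket of an amalgamation can enter several fibres of a condition, so a
  single colour must be harmless for all of them.\<close>

context
  fixes c :: "omega1 \<Rightarrow> nat" and \<G> :: "nat set set"
  assumes empty_G: "{} \<in> \<G>"
    and subset_G: "\<And>H H'. H \<in> \<G> \<Longrightarrow> H' \<subseteq> H \<Longrightarrow> H' \<in> \<G>"
    and extend_G: "\<And>\<H>. finite \<H> \<Longrightarrow> \<H> \<subseteq> \<G> \<Longrightarrow>
      - (c -` {w. \<forall>H\<in>\<H>. insert w H \<in> \<G>}) \<notin> VF \<tau> F"
begin

text \<open>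
  A condition is a finite set of pairs (ordinal, index) each of whose fibres has its brackets coloured
  by a member of \<open>\<G>\<close>. Since an unused index is always available, every ordinal is in the domain of
  densely many conditions, so the generic fibres cover \<open>\<omega>\<^sub>1\<close> and one of them is uncountable; no
  condition forcing a generic set to be uncountable has to be found.
\<close>

definition fibre :: "(omega1 \<times> nat) set \<Rightarrow> nat \<Rightarrow> omega1 set" where
  "fibre p v = {\<xi>. (\<xi>, v) \<in> p}"

definition colours :: "(omega1 \<times> nat) set \<Rightarrow> nat \<Rightarrow> nat set" where
  "colours p v = c ` bracket_set \<tau> F (fibre p v)"

definition good_cond :: "(omega1 \<times> nat) set \<Rightarrow> bool" where
  "good_cond p \<longleftrightarrow> finite p \<and> (\<forall>v. colours p v \<in> \<G>)"

text \<open>The graph codes the whole colour assignment of a condition, and there are only countably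
  many finite graphs.\<close>

lemma finite_Sigma_colours:
  assumes "finite p"
  shows "finite {(v, w). w \<in> colours p v}"
proof -
  have "{(v, w). w \<in> colours p v} \<subseteq> (SIGMA v:snd ` p. colours p v)"
    by (force simp: colours_def bracket_set_def fibre_def)
  moreover have "fibre p v \<subseteq> fst ` p" for v by (force simp: fibre_def)
  then have "finite (fibre p v)" for v using assms finite_subset by blast
  then have "finite (colours p v)" for v by (simp add: colours_def finite_bracket_set)
  then have "finite (SIGMA v:snd ` p. colours p v)" using assms by simp
  ultimately show ?thesis by (rule finite_subset)
qed

text \<open>Conditions are first thinned to a common colour assignment \<open>h0\<close>. This fixes
  the set \<open>W\<close> of harmless colours before \<open>common_capture\<close> is asked for a
  bracket in it. The sets \<open>x i\<close> are carried along for preserving 2-capturing.\<close>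

lemma amalgamate:
  fixes I :: "'i set" and x :: "'i \<Rightarrow> omega1 set"
  assumes I: "uncountable I" and p: "\<And>i. i \<in> I \<Longrightarrow> good_cond (p i)"
    and x: "\<And>i. i \<in> I \<Longrightarrow> finite (x i)"
  obtains i j l where "i \<in> I" "j \<in> I" "i \<noteq> j" "N \<le> l" "good_cond (p i \<union> p j)"
    "x i \<noteq> x j \<Longrightarrow> captured_family \<tau> F 2 {x i, x j} l"
proof -
  define h where "h i = {(v, w). w \<in> colours (p i) v}" for i
  have fin: "finite (p i)" if "i \<in> I" for i using p[OF that] by (simp add: good_cond_def)
  have "h ` I \<subseteq> {A. finite A}" using fin finite_Sigma_colours by (auto simp: h_def)
  then have "countable (h ` I)" using countable_finite_subsets countable_subset by blast
  then obtain h0 where I': "uncountable {i \<in> I. h i = h0}" (is "uncountable ?I")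
    using uncountable_fibre[OF I] by blast
  have colours_h0: "colours (p i) v = {w. (v, w) \<in> h0}" if "i \<in> ?I" for i v
    using that by (auto simp: h_def)
  obtain i0 where i0: "i0 \<in> ?I" using I' by (metis (no_types, lifting) countable_empty equals0I)
  \<comment> \<open>The empty set accounts for the infinitely many indices whose fibre has no
    bracket.\<close>
  define \<H> where "\<H> = insert {} ((\<lambda>v. {w. (v, w) \<in> h0}) ` fst ` h0)"
  have "finite h0" using i0 finite_Sigma_colours[OF fin] by (auto simp: h_def)
  then have fin_H: "finite \<H>" by (simp add: \<H>_def)
  have sub_H: "\<H> \<subseteq> \<G>"
  proof
    fix H assume "H \<in> \<H>"
    then have "H = {} \<or> (\<exists>v. H = colours (p i0) v)" using colours_h0[OF i0] by (auto simp: \<H>_def)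
    then show "H \<in> \<G>" using empty_G p i0 by (auto simp: good_cond_def)
  qed
  have in_H: "{w. (v, w) \<in> h0} \<in> \<H>" for v
    by (cases "v \<in> fst ` h0") (auto simp: \<H>_def image_iff)
  define W where "W = c -` {w. \<forall>H\<in>\<H>. insert w H \<in> \<G>}"
  have W: "- W \<notin> VF \<tau> F" unfolding W_def by (rule extend_G[OF fin_H sub_H])
  define y where "y i = fst ` p i \<union> x i" for i
  \<comment> \<open>Positions are recorded together with their indices, so corresponding fibres have
    the same positions and \<open>bracket_set_Un\<close> applies to each fibre separately.\<close>
  define f where "f k i = ((\<lambda>\<xi>. nrm \<xi> k) ` x i, (\<lambda>(\<xi>, v). (nrm \<xi> k, v)) ` p i)" for k i
  have fin_y: "finite (y i)" if "i \<in> ?I" for i using that fin x by (auto simp: y_def)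
  have f_C: "f k i \<in> {A. finite A} \<times> {A. finite A}" if "i \<in> ?I" for k i
    using that fin x by (auto simp: f_def)
  have C: "countable ({A :: nat set. finite A} \<times> {A :: (nat \<times> nat) set. finite A})"
    by (intro countable_SIGMA countable_finite_subsets)
  obtain i j k l \<alpha> \<beta> where ij: "i \<in> ?I" "j \<in> ?I" "i \<noteq> j" and k: "N \<le> k"
    and captured_at: "captured_at l \<alpha> \<beta>" "nrm \<alpha> k = nrm \<beta> k"
    and y: "y i \<subseteq> cl \<alpha> k" "y j \<subseteq> cl \<beta> k" and f: "f k i = f k j" and b: "bracket \<tau> F \<alpha> \<beta> \<in> W"
    using common_capture[OF I' fin_y C f_C W] .
  have "colours (p i \<union> p j) v \<in> \<G>" for v
  proof -
    let ?H = "{w. (v, w) \<in> h0}"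
    have "fibre (p i) v \<subseteq> cl \<alpha> k" "fibre (p j) v \<subseteq> cl \<beta> k"
      using y by (force simp: y_def fibre_def)+
    moreover have "(\<lambda>\<xi>. nrm \<xi> k) ` fibre q v = {a. (a, v) \<in> (\<lambda>(\<xi>, v). (nrm \<xi> k, v)) ` q}" for q
      by (force simp: fibre_def)
    then have "(\<lambda>\<xi>. nrm \<xi> k) ` fibre (p i) v = (\<lambda>\<xi>. nrm \<xi> k) ` fibre (p j) v"
      using f by (simp add: f_def)
    ultimately have "bracket_set \<tau> F (fibre (p i) v \<union> fibre (p j) v)
        \<subseteq> insert (bracket \<tau> F \<alpha> \<beta>) (bracket_set \<tau> F (fibre (p i) v) \<union> bracket_set \<tau> F (fibre (p j) v))"
      by (rule bracket_set_Un[OF captured_at])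
    moreover have "fibre (p i \<union> p j) v = fibre (p i) v \<union> fibre (p j) v" by (auto simp: fibre_def)
    ultimately have "colours (p i \<union> p j) v
        \<subseteq> insert (c (bracket \<tau> F \<alpha> \<beta>)) (colours (p i) v \<union> colours (p j) v)"
      unfolding colours_def by (metis image_Un image_insert image_mono)
    also have "\<dots> = insert (c (bracket \<tau> F \<alpha> \<beta>)) ?H"
      unfolding colours_h0[OF ij(1)] colours_h0[OF ij(2)] by simp
    finally have "colours (p i \<union> p j) v \<subseteq> insert (c (bracket \<tau> F \<alpha> \<beta>)) ?H" .
    moreover have "insert (c (bracket \<tau> F \<alpha> \<beta>)) ?H \<in> \<G>" using b in_H unfolding W_def by blast
    ultimately show ?thesis using subset_G by blast
  qed
  then have "good_cond (p i \<union> p j)" using fin ij by (simp add: good_cond_def)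
  moreover have "captured_family \<tau> F 2 {x i, x j} l" if "x i \<noteq> x j"
  proof (rule captured_family_if_captured_at[OF captured_at _ _ _ that])
    show "x i \<subseteq> cl \<alpha> k" "x j \<subseteq> cl \<beta> k" using y by (auto simp: y_def)
    show "(\<lambda>\<xi>. nrm \<xi> k) ` x i = (\<lambda>\<xi>. nrm \<xi> k) ` x j" using f by (simp add: f_def)
  qed
  moreover have "N \<le> l" using captured_at_level_gt[OF captured_at] k by simp
  ultimately show thesis using that ij by blast
qed

text \<open>Homogeneity is stated for finite \<open>T\<close> because directedness of the filter
  gathers \<open>T\<close> times one index into a single condition. It also permits
  \<open>\<G>\<close> to consist of finite sets only.\<close>

lemma homogeneous_set_exists:
  assumes large: "|UNIV :: omega1 set| \<le>o |UNIV :: 'p set|"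
    and mart: "|UNIV :: omega1 set| <o (mart_scheme \<tau> F :: 'p set rel)"
  shows "\<exists>S. uncountable S \<and> (\<forall>T. finite T \<longrightarrow> T \<subseteq> S \<longrightarrow> c ` bracket_set \<tau> F T \<in> \<G>)"
proof -
  have inf: "infinite (UNIV :: omega1 set)" using uncountable_omega1 countable_finite by blast
  have "|UNIV :: nat set| \<le>o |UNIV :: omega1 set|"
    using inf infinite_iff_card_of_nat by blast
  then have "|(UNIV :: omega1 set) \<times> (UNIV :: nat set)| \<le>o |UNIV :: omega1 set|"
    by (rule card_of_Times_ordLeq_self[OF inf])
  moreover have "|Fpow (UNIV :: (omega1 \<times> nat) set)| \<le>o |UNIV :: (omega1 \<times> nat) set|"
    by (rule card_of_Fpow_ordLeq_infinite) (simp add: finite_prod inf)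
  ultimately have "|Fpow (UNIV :: (omega1 \<times> nat) set)| \<le>o |UNIV :: 'p set|"
    using large unfolding UNIV_Times_UNIV by (metis ordLeq_transitive)
  \<comment> \<open>The forcing lives on the image of this injection; \<open>d\<close> below decodes
    its conditions.\<close>
  then obtain e :: "(omega1 \<times> nat) set \<Rightarrow> 'p" where e: "inj_on e (Fpow UNIV)"
    by (auto simp flip: card_of_ordLeq)
  have e_eq: "e p = e q \<longleftrightarrow> p = q" if "good_cond p" "good_cond q" for p q
    using that e by (auto simp: Fpow_def good_cond_def inj_on_def)
  define P where "P = {(e q, e p) |q p. good_cond p \<and> good_cond q \<and> p \<subseteq> q}"
  have P_iff: "(e q, e p) \<in> P \<longleftrightarrow> p \<subseteq> q" if "good_cond p" "good_cond q" for p q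
    using that e_eq unfolding P_def by blast
  have Field: "Field P = e ` {p. good_cond p}" unfolding P_def Field_def by auto
  have "refl_on (Field P) P" unfolding refl_on_def Field using P_iff by auto
  moreover have "trans P"
  proof (rule transI)
    fix a b d assume "(a, b) \<in> P" "(b, d) \<in> P"
    then obtain p q q' s where *: "a = e q" "b = e p" "b = e q'" "d = e s"
      "good_cond p" "good_cond q" "p \<subseteq> q" "good_cond q'" "good_cond s" "s \<subseteq> q'"
      unfolding P_def by blast
    then have "p = q'" using e_eq by metis
    then show "(a, d) \<in> P" using * P_iff by auto
  qed
  moreover have good_single: "good_cond {(\<xi>, v)}" for \<xi> v
  proof -
    have "bracket_set \<tau> F (fibre {(\<xi>, v)} w) = {}" for w
      by (auto simp: bracket_set_def fibre_def)
    then show ?thesis using empty_G by (simp add: good_cond_def colours_def)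
  qed
  have "Field P \<noteq> {}" unfolding Field using good_single by blast
  ultimately have forcing: "forcing_notion P"
    by (auto simp: forcing_notion_def preorder_on_def Field_def)
  define d where "d = inv_into {p. good_cond p} e"
  have d: "good_cond (d a)" "e (d a) = a" if "a \<in> Field P" for a
    using that inv_into_into[of a e "{p. good_cond p}"] f_inv_into_f[of a e "{p. good_cond p}"]
    by (auto simp: d_def Field)
  have ccc: "ccc P"
    unfolding ccc_def
  proof (intro allI impI, rule ccontr)
    fix A assume A: "A \<subseteq> Field P" "\<forall>p\<in>A. \<forall>q\<in>A. p \<noteq> q \<longrightarrow> \<not> compatible P p q" "uncountable A"
    have dA: "good_cond (d a)" if "a \<in> A" for a using d A(1) that by blast
    obtain a b where ab: "a \<in> A" "b \<in> A" "a \<noteq> b" "good_cond (d a \<union> d b)"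
      by (rule amalgamate[where I = A and p = d and x = "\<lambda>_. {}" and N = 0]) (use A(3) dA in auto)
    have "(e (d a \<union> d b), e (d a)) \<in> P" "(e (d a \<union> d b), e (d b)) \<in> P"
      using P_iff ab dA by auto
    moreover have "e (d a) = a" "e (d b) = b" using d(2) A(1) ab by blast+
    ultimately have "compatible P a b" unfolding compatible_def by metis
    then show False using A(2) ab by blast
  qed
  have forced: "forced P (fcapturing P \<tau> F 2)"
  proof (rule forced_fcapturingI[OF forcing])
    fix B :: "omega1 set set" and t :: "omega1 set \<Rightarrow> 'p" and N
    assume B: "uncountable B" "\<forall>x\<in>B. finite x \<and> t x \<in> Field P"
    have dB: "good_cond (d (t x))" "finite x" if "x \<in> B" for x using d B(2) that by blast+
    \<comment> \<open>Each set of the family is attached to its own condition, so compatibility and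
      capture are obtained for the same two sets.\<close>
    obtain x y l where xy: "x \<in> B" "y \<in> B" "x \<noteq> y" "N \<le> l" "good_cond (d (t x) \<union> d (t y))"
      "x \<noteq> y \<Longrightarrow> captured_family \<tau> F 2 {x, y} l"
      by (rule amalgamate[where I = B and p = "\<lambda>x. d (t x)" and x = "\<lambda>x. x" and N = N])
        (use B(1) dB in auto)
    have "(e (d (t x) \<union> d (t y)), e (d (t x))) \<in> P" "(e (d (t x) \<union> d (t y)), e (d (t y))) \<in> P"
      using P_iff xy dB by auto
    moreover have "e (d (t x)) = t x" "e (d (t y)) = t y" using d(2) B(2) xy by blast+
    ultimately show "\<exists>x\<in>B. \<exists>y\<in>B. \<exists>l\<ge>N. \<exists>s. (s, t x) \<in> P \<and> (s, t y) \<in> P \<and> captured_family \<tau> F 2 {x, y} l"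
      using xy by metis
  qed
  define Dns where "Dns \<xi> = e ` {p. good_cond p \<and> \<xi> \<in> fst ` p}" for \<xi>
  have dense: "dense_subset P (Dns \<xi>)" for \<xi>
    unfolding dense_subset_def
  proof (intro conjI ballI)
    show "Dns \<xi> \<subseteq> Field P" by (auto simp: Dns_def Field)
    fix a assume "a \<in> Field P"
    then obtain p where p: "good_cond p" "a = e p" by (auto simp: Field)
    have "finite (snd ` p)" using p by (simp add: good_cond_def)
    then obtain v where v: "v \<notin> snd ` p" using ex_new_if_finite infinite_UNIV_nat by blast
    have "fibre (insert (\<xi>, v) p) w = (if w = v then {\<xi>} else fibre p w)" for w
      using v by (force simp: fibre_def)
    moreover have "bracket_set \<tau> F {\<xi>} = {}" by (auto simp: bracket_set_def)
    ultimately have "good_cond (insert (\<xi>, v) p)"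
      using p(1) empty_G by (simp add: good_cond_def colours_def)
    then show "\<exists>b\<in>Dns \<xi>. (b, a) \<in> P" using p P_iff[of p "insert (\<xi>, v) p"] by (auto simp: Dns_def)
  qed
  have "|range Dns| \<le>o |UNIV :: omega1 set|" by (rule card_of_image)
  moreover have "dense_subset P D" if "D \<in> range Dns" for D using dense that by blast
  ultimately obtain G where filter: "forcing_filter P G" and meets: "\<And>D. D \<in> range Dns \<Longrightarrow> G \<inter> D \<noteq> {}"
    using generic_filter_exists[OF mart forcing ccc forced] by metis
  have G: "forcing_filter P G" "\<And>\<xi>. \<exists>a. a \<in> G \<and> a \<in> Dns \<xi>"
    using filter meets by blast+
  define S where "S v = {\<xi>. \<exists>p. good_cond p \<and> e p \<in> G \<and> (\<xi>, v) \<in> p}" for v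
  have below: "\<exists>p. good_cond p \<and> e p \<in> G \<and> T \<times> {v} \<subseteq> p" if "finite T" "T \<subseteq> S v" for T v
    using that
  proof (induction T)
    case empty
    obtain \<xi> :: omega1 and a where "a \<in> G" "a \<in> Dns \<xi>" using G(2) by blast
    then show ?case by (auto simp: Dns_def)
  next
    case (insert \<xi> T)
    then obtain p where p: "good_cond p" "e p \<in> G" "T \<times> {v} \<subseteq> p" by blast
    obtain q where q: "good_cond q" "e q \<in> G" "(\<xi>, v) \<in> q" using insert.prems by (auto simp: S_def)
    obtain a where a: "a \<in> G" "(a, e p) \<in> P" "(a, e q) \<in> P"
      using G(1) p(2) q(2) unfolding forcing_filter_def by blast
    have "a \<in> Field P" using a(2) by (auto simp: Field_def)
    then obtain s where s: "good_cond s" "a = e s" by (auto simp: Field)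
    have "p \<subseteq> s" "q \<subseteq> s" using a(2,3) P_iff s p(1) q(1) by auto
    then have "insert \<xi> T \<times> {v} \<subseteq> s" using p(3) q(3) by auto
    then show ?case using s a(1) by blast
  qed
  have S: "c ` bracket_set \<tau> F T \<in> \<G>" if T: "finite T" "T \<subseteq> S v" for T v
  proof -
    obtain p where "good_cond p" "T \<times> {v} \<subseteq> p" using below[OF T] by blast
    then have "colours p v \<in> \<G>" "T \<subseteq> fibre p v" by (auto simp: good_cond_def fibre_def)
    then show ?thesis
      using subset_G[OF _ image_mono[OF bracket_set_mono]] unfolding colours_def by blast
  qed
  have "(\<Union>v. S v) = UNIV"
  proof (intro equalityI subset_UNIV subsetI)
    fix \<xi>
    obtain a where "a \<in> G" "a \<in> Dns \<xi>" using G(2) by blast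
    then show "\<xi> \<in> (\<Union>v. S v)" by (force simp: Dns_def S_def)
  qed
  then have "\<not> (\<forall>v. countable (S v))" using uncountable_omega1 countable_UN[of UNIV S] by auto
  then show ?thesis using S by blast
qed

end

section \<open>The ultrafilter\<close>

context
  assumes capturing: "capturing \<tau> F 2"
    and large: "|UNIV :: omega1 set| \<le>o |UNIV :: 'p set|"
    and mart: "|UNIV :: omega1 set| <o (mart_scheme \<tau> F :: 'p set rel)"
begin

lemma VF_dichotomy: "A \<in> VF \<tau> F \<or> - A \<in> VF \<tau> F"
proof (rule ccontr)
  assume not: "\<not> ?thesis"
  define c :: "omega1 \<Rightarrow> nat" where "c \<xi> = (if \<xi> \<in> A then 1 else 0)" for \<xi>
  \<comment> \<open>Only the colour 1 is permitted, so an uncountable homogeneous set has all its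
    brackets in \<open>A\<close>.\<close>
  let ?G = "{{}, {1}} :: nat set set"
  have ext: "- (c -` {w. \<forall>H\<in>\<H>. insert w H \<in> ?G}) \<notin> VF \<tau> F" if "\<H> \<subseteq> ?G" for \<H>
  proof -
    have "\<forall>H\<in>\<H>. insert 1 H \<in> ?G" using that by auto
    then have "- (c -` {w. \<forall>H\<in>\<H>. insert w H \<in> ?G}) \<subseteq> - A" by (auto simp: c_def)
    then show ?thesis using not VF_mono[of _ \<tau> F "- A"] by auto
  qed
  have sub: "H' \<in> ?G" if "H \<in> ?G" "H' \<subseteq> H" for H H' using that by auto
  obtain S where S: "uncountable S" "\<And>T. finite T \<Longrightarrow> T \<subseteq> S \<Longrightarrow> c ` bracket_set \<tau> F T \<in> ?G"
  proof -
    have "\<exists>S. uncountable S \<and> (\<forall>T. finite T \<longrightarrow> T \<subseteq> S \<longrightarrow> c ` bracket_set \<tau> F T \<in> ?G)"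
      by (rule homogeneous_set_exists[OF _ sub ext large mart]) simp
    then show thesis using that by blast
  qed
  have "bracket_set \<tau> F S \<subseteq> A"
  proof
    fix \<gamma> assume "\<gamma> \<in> bracket_set \<tau> F S"
    then obtain \<alpha> \<beta> where \<alpha>\<beta>: "\<alpha> \<in> S" "\<beta> \<in> S" "\<gamma> \<in> bracket_set \<tau> F {\<alpha>, \<beta>}"
      unfolding bracket_set_def by blast
    then have "c \<gamma> \<in> c ` bracket_set \<tau> F {\<alpha>, \<beta>}" by blast
    moreover have "c ` bracket_set \<tau> F {\<alpha>, \<beta>} \<in> ?G" using S(2) \<alpha>\<beta> by simp
    ultimately have "c \<gamma> = 1" by auto
    then show "\<gamma> \<in> A" by (simp add: c_def split: if_splits)
  qed
  then show False using S(1) not unfolding VF_def by blast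
qed

context
  fixes \<pi> :: "omega1 \<Rightarrow> nat"
begin

lemma pushforward_ultrafilter: "is_ultrafilter {A. \<pi> -` A \<in> VF \<tau> F}"
  unfolding is_ultrafilter_def mem_Collect_eq
proof (intro conjI allI impI)
  note empty = empty_not_VF[OF capturing]
  show "\<pi> -` UNIV \<in> VF \<tau> F" using uncountable_omega1 by (auto simp: VF_def)
  show "\<pi> -` {} \<notin> VF \<tau> F" using empty by simp
  show "\<pi> -` B \<in> VF \<tau> F" if "\<pi> -` A \<in> VF \<tau> F \<and> A \<subseteq> B" for A B
    using that VF_mono[of "\<pi> -` A"] by blast
  show "\<pi> -` (A \<inter> B) \<in> VF \<tau> F" if "\<pi> -` A \<in> VF \<tau> F \<and> \<pi> -` B \<in> VF \<tau> F" for A B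
  proof (rule ccontr)
    assume "\<pi> -` (A \<inter> B) \<notin> VF \<tau> F"
    then have "- (\<pi> -` (A \<inter> B)) \<in> VF \<tau> F" using VF_dichotomy by blast
    then have "\<pi> -` A \<inter> \<pi> -` B \<inter> - (\<pi> -` (A \<inter> B)) \<noteq> {}" using VF_Int[OF empty] that by blast
    then show False by auto
  qed
  show "\<pi> -` A \<in> VF \<tau> F \<or> \<pi> -` (- A) \<in> VF \<tau> F" for A
    using VF_dichotomy[of "\<pi> -` A"] by (simp add: vimage_Compl)
qed

lemma finite_Union_not_VF:
  assumes "finite \<Q>" "\<And>X. X \<in> \<Q> \<Longrightarrow> \<pi> -` X \<notin> VF \<tau> F"
  shows "\<pi> -` \<Union>\<Q> \<notin> VF \<tau> F"
proof -
  note uf = pushforward_ultrafilter[unfolded is_ultrafilter_def mem_Collect_eq]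
  have compl: "\<pi> -` (- A) \<in> VF \<tau> F \<longleftrightarrow> \<pi> -` A \<notin> VF \<tau> F" for A
  proof -
    have "\<pi> -` (A \<inter> - A) \<notin> VF \<tau> F" using uf by simp
    then show ?thesis using uf by blast
  qed
  have "\<pi> -` (- \<Union>\<Q>) \<in> VF \<tau> F"
    using assms
  proof (induction \<Q>)
    case empty
    then show ?case using uf by simp
  next
    case (insert X \<Q>)
    then have "\<pi> -` (- X) \<in> VF \<tau> F" "\<pi> -` (- \<Union>\<Q>) \<in> VF \<tau> F" using compl by auto
    then have "\<pi> -` (- X \<inter> - \<Union>\<Q>) \<in> VF \<tau> F" using uf by blast
    then show ?case by simp
  qed
  then show ?thesis using compl by blast
qed

text \<open>The permitted colour sets are the finite partial selectors. Finitely many of them touch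
  finitely many pieces, whose union is not in the ultrafilter, and any colour outside that union
  extends all of them.\<close>

lemma pushforward_selector:
  assumes \<P>: "partition_on UNIV \<P>" "\<P> \<inter> {A. \<pi> -` A \<in> VF \<tau> F} = {}"
  shows "\<exists>A. \<pi> -` A \<in> VF \<tau> F \<and> (\<forall>X\<in>\<P>. \<forall>x\<in>A \<inter> X. \<forall>y\<in>A \<inter> X. x = y)"
proof -
  define \<G> where "\<G> = {H. finite H \<and> (\<forall>X\<in>\<P>. \<forall>x\<in>H \<inter> X. \<forall>y\<in>H \<inter> X. x = y)}"
  have empty: "{} \<in> \<G>" by (simp add: \<G>_def)
  have sub: "H' \<in> \<G>" if "H \<in> \<G>" "H' \<subseteq> H" for H H'
    using that finite_subset unfolding \<G>_def by blast
  have ext: "- (\<pi> -` {w. \<forall>H\<in>\<H>. insert w H \<in> \<G>}) \<notin> VF \<tau> F" if \<H>: "finite \<H>" "\<H> \<subseteq> \<G>" for \<H>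
  proof -
    define \<Q> where "\<Q> = {X \<in> \<P>. \<Union>\<H> \<inter> X \<noteq> {}}"
    have "\<forall>X\<in>\<Q>. \<exists>x. x \<in> \<Union>\<H> \<inter> X" by (auto simp: \<Q>_def)
    then obtain g where g: "\<And>X. X \<in> \<Q> \<Longrightarrow> g X \<in> \<Union>\<H> \<inter> X" by metis
    have disj: "X = Y" if "X \<in> \<P>" "Y \<in> \<P>" "z \<in> X" "z \<in> Y" for X Y z
      using \<P>(1) that unfolding partition_on_def disjoint_def by blast
    have "inj_on g \<Q>"
    proof (rule inj_onI)
      \<comment> \<open>Pieces are disjoint, so a point chosen in each touched piece identifies the
        piece. This bounds their number by the size of the finite set
        \<open>\<Union>\<H>\<close>.\<close>
      fix X Y assume XY: "X \<in> \<Q>" "Y \<in> \<Q>" "g X = g Y"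
      then have "X \<in> \<P>" "Y \<in> \<P>" "g X \<in> X" "g X \<in> Y" using g[of X] g[of Y] by (auto simp: \<Q>_def)
      then show "X = Y" by (rule disj)
    qed
    moreover have "finite (\<Union>\<H>)" using \<H> by (auto simp: \<G>_def)
    moreover have "g ` \<Q> \<subseteq> \<Union>\<H>" using g by blast
    ultimately have "finite \<Q>" by (meson finite_imageD finite_subset)
    moreover have "\<pi> -` X \<notin> VF \<tau> F" if "X \<in> \<Q>" for X using that \<P>(2) by (auto simp: \<Q>_def)
    ultimately have "\<pi> -` \<Union>\<Q> \<notin> VF \<tau> F" by (rule finite_Union_not_VF)
    moreover have "insert w H \<in> \<G>" if w: "w \<notin> \<Union>\<Q>" and H: "H \<in> \<H>" for w H
    proof -
      have "H \<in> \<G>" using H \<H>(2) by blast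
      moreover have "H \<inter> X = {}" if "X \<in> \<P>" "w \<in> X" for X
        using w H that by (auto simp: \<Q>_def)
      ultimately show ?thesis unfolding \<G>_def by blast
    qed
    then have "- (\<pi> -` {w. \<forall>H\<in>\<H>. insert w H \<in> \<G>}) \<subseteq> \<pi> -` \<Union>\<Q>" by blast
    ultimately show ?thesis using VF_mono by blast
  qed
  have "\<exists>S. uncountable S \<and> (\<forall>T. finite T \<longrightarrow> T \<subseteq> S \<longrightarrow> \<pi> ` bracket_set \<tau> F T \<in> \<G>)"
    by (rule homogeneous_set_exists[OF empty sub ext large mart])
  then obtain S where S: "uncountable S" "\<And>T. finite T \<Longrightarrow> T \<subseteq> S \<Longrightarrow> \<pi> ` bracket_set \<tau> F T \<in> \<G>"
    by blast
  show ?thesis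
  proof (intro exI conjI ballI)
    show "\<pi> -` (\<pi> ` bracket_set \<tau> F S) \<in> VF \<tau> F" using S(1) by (auto simp: VF_def)
    fix X x y assume X: "X \<in> \<P>" "x \<in> \<pi> ` bracket_set \<tau> F S \<inter> X" "y \<in> \<pi> ` bracket_set \<tau> F S \<inter> X"
    \<comment> \<open>Each value comes from two ordinals of \<open>S\<close>, so two values of one
      piece already occur over a finite subset of \<open>S\<close>, where homogeneity identifies
      them.\<close>
    have local: "\<exists>T. finite T \<and> T \<subseteq> S \<and> z \<in> \<pi> ` bracket_set \<tau> F T" if z: "z \<in> \<pi> ` bracket_set \<tau> F S" for z
    proof -
      obtain \<alpha> \<beta> where \<alpha>\<beta>: "\<alpha> \<in> S" "\<beta> \<in> S" "z \<in> \<pi> ` bracket_set \<tau> F {\<alpha>, \<beta>}"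
        using z unfolding bracket_set_def by blast
      then show ?thesis by (intro exI[of _ "{\<alpha>, \<beta>}"]) simp
    qed
    obtain T where T: "finite T" "T \<subseteq> S" "x \<in> \<pi> ` bracket_set \<tau> F T" using local[of x] X(2) by auto
    obtain U where U: "finite U" "U \<subseteq> S" "y \<in> \<pi> ` bracket_set \<tau> F U" using local[of y] X(3) by auto
    have "x \<in> \<pi> ` bracket_set \<tau> F (T \<union> U)" "y \<in> \<pi> ` bracket_set \<tau> F (T \<union> U)"
      using T(3) U(3) image_mono[OF bracket_set_mono[of T "T \<union> U" \<tau> F], of \<pi>]
        image_mono[OF bracket_set_mono[of U "T \<union> U" \<tau> F], of \<pi>] by auto
    moreover have "\<pi> ` bracket_set \<tau> F (T \<union> U) \<in> \<G>" using S(2) T U by simp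
    ultimately show "x = y" using X unfolding \<G>_def mem_Collect_eq by (meson IntD2 IntI)
  qed
qed

end

end

end

theorem mainTheorem18:fixes \<tau> :: scheme_type and F :: "omega1 set set" and \<pi> :: "omega1 \<Rightarrow> nat"
  assumes "good_type \<tau>"
    and "construction_scheme \<tau> F"
    and "capturing \<tau> F 2"
    and "|UNIV :: omega1 set| \<le>o |UNIV :: 'p set|"
    and "|UNIV :: omega1 set| <o (mart_scheme \<tau> F :: 'p set rel)"
    and "surj \<pi>"
    and "\<And>n. \<pi> -` {n} \<notin> VF \<tau> F"
  shows "ramsey_ultrafilter {A. \<pi> -` A \<in> VF \<tau> F}"
proof -
  interpret scheme \<tau> F using assms(1,2) by unfold_locales
  show ?thesis
    unfolding ramsey_ultrafilter_def
  proof (intro conjI allI impI)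
    show "is_ultrafilter {A. \<pi> -` A \<in> VF \<tau> F}"
      by (rule pushforward_ultrafilter[OF assms(3-5)])
    fix \<P> assume \<P>: "partition_on UNIV \<P> \<and> infinite \<P> \<and> \<P> \<inter> {A. \<pi> -` A \<in> VF \<tau> F} = {}"
    then have "partition_on UNIV \<P>" "\<P> \<inter> {A. \<pi> -` A \<in> VF \<tau> F} = {}" by blast+
    from pushforward_selector[OF assms(3-5) this]
    show "\<exists>A\<in>{A. \<pi> -` A \<in> VF \<tau> F}. \<forall>X\<in>\<P>. \<forall>x\<in>A \<inter> X. \<forall>y\<in>A \<inter> X. x = y" by simp
  qed
qed

end
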